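(* Let $m\ge 0$ be an integer and $1\le p<\infty$. If $g\in\mathcal{VMO}^p$ (with $g\in\Omega_m$), then the Hankel operators $H_g^p$ and $H_{\bar g}^p$ are both compact as operators from $\mathscr{F}^{p,m}$ to $L^{p,m}$.
   Context: $dA$ is Lebesgue area measure on $\mathbb{C}$, and $m$ is a fixed non-negative integer. For $1\le p<\infty$, $L^{p,m}$ is the space of Lebesgue measurable $f$ on $\mathbb{C}$ with $\|f\|_{p,m}=\{\omega_{p,m}\int_{\mathbb{C}}|f(v)|^p|v|^{mp}e^{-\frac p2|v|^2}dA(v)\}^{1/p}<\infty$, where $\omega_{p,m}=(\tfrac p2)^{\frac{mp}{2}+1}\frac{1}{\pi\Gamma(\frac{mp}{2}+1)}$. The Fock-Sobolev space $\mathscr{F}^{p,m}$ is the closed subspace of entire functions in $L^{p,m}$, with the same norm. The reproducing kernel of $\mathscr{F}^{2,m}$ is $K_z^m(v)=\sum_{k=0}^\infty\frac{m!}{(k+m)!}(\bar z v)^k$, and $k_z^m=K_z^m/\sqrt{K_z^m(z)}$. The projection is $P^m f(z)=\frac{1}{\pi m!}\int_{\mathbb{C}}f(v)\overline{K_z^m(v)}|v|^{2m}e^{-|v|^2}dA(v)$; it is a bounded projection of $L^{p,m}$ onto $\mathscr{F}^{p,m}$. $\Omega_m$ is the set of measurable $g$ on $\mathbb{C}$ such that $gk_v^m\in\bigcup_{p'\ge1}L^{p',m}$ for each $v\in\mathbb{C}$. For $g\in\Omega_m$ the Hankel operator $H_g^p:\mathscr{F}^{p,m}\to L^{p,m}$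 is $H_g^pf=(I-P^m)(gf)$, i.e. $H_g^pf(z)=\frac{1}{\pi m!}\int_{\mathbb{C}}(g(z)-g(v))f(v)\overline{K_z^m(v)}|v|^{2m}e^{-|v|^2}dA(v)$, for those $f\in\mathscr{F}^{p,m}$ for which the integral converges absolutely for almost every $z$ (in particular on the linear span of the kernel functions $k_v^m$). $\mathscr{B}(z;r)=\{v\in\mathbb{C}:|v-z|\le r\}$. $L^p_{Loc}$ is the space of measurable functions on $\mathbb{C}$ that are in $L^p(K,dA)$ for every compact $K\subset\mathbb{C}$. Put $\tilde g_r(z)=\frac1{\pi r^2}\int_{\mathscr{B}(z;r)}g\,dA$. For $r>0$, $\mathcal{VMO}_r^p$ is the set of $g\in L^p_{Loc}$ with $\lim_{|z|\to\infty}\left\{\frac1{\pi r^2}\int_{\mathscr{B}(z;r)}|g(v)-\tilde g_r(z)|^pdA(v)\right\}^{1/p}=0$. This space does not depend on $r>0$ and is written $\mathcal{VMO}^p$. *)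

theory Defs
  imports "HOL-Complex_Analysis.Complex_Analysis"
begin

text \<open>
  Elements of the weighted Lebesgue spaces are represented by functions rather than by
  classes of functions modulo equality almost everywhere, so \<open>Lnorm p m\<close> is a seminorm on
  \<open>Lspace p m\<close>.  The area measure \<open>dA\<close> is \<open>lebesgue :: complex measure\<close>.
  The factor \<open>|v|^(mp)\<close> is written \<open>(cmod v ^ m) powr p\<close> because \<open>0 powr 0 = 0\<close>.
\<close>

definition Lweight :: "real \<Rightarrow> nat \<Rightarrow> complex \<Rightarrow> real" where
  "Lweight p m v = (cmod v ^ m) powr p * exp (- (p / 2) * (cmod v)\<^sup>2)"

definition Lspace :: "real \<Rightarrow> nat \<Rightarrow> (complex \<Rightarrow> complex) set" where
  "Lspace p m = {f. f \<in> borel_measurable lebesgue \<and>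
     integrable lebesgue (\<lambda>v. cmod (f v) powr p * Lweight p m v)}"

definition omega :: "real \<Rightarrow> nat \<Rightarrow> real" where
  "omega p m = (p / 2) powr (real m * p / 2 + 1) * (1 / (pi * Gamma (real m * p / 2 + 1)))"

definition Lnorm :: "real \<Rightarrow> nat \<Rightarrow> (complex \<Rightarrow> complex) \<Rightarrow> real" where
  "Lnorm p m f =
     (omega p m * (LINT v|lebesgue. cmod (f v) powr p * Lweight p m v)) powr (1 / p)"

definition Fock_Sobolev :: "real \<Rightarrow> nat \<Rightarrow> (complex \<Rightarrow> complex) set" where
  "Fock_Sobolev p m = {f \<in> Lspace p m. f holomorphic_on UNIV}"

definition kernel :: "nat \<Rightarrow> complex \<Rightarrow> complex \<Rightarrow> complex" where
  "kernel m z v = (\<Sum>k. of_real (fact m / fact (k + m)) * (cnj z * v) ^ k)"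

definition normalized_kernel :: "nat \<Rightarrow> complex \<Rightarrow> complex \<Rightarrow> complex" where
  "normalized_kernel m z v = kernel m z v / csqrt (kernel m z z)"

definition Omega :: "nat \<Rightarrow> (complex \<Rightarrow> complex) set" where
  "Omega m = {g. g \<in> borel_measurable lebesgue \<and>
     (\<forall>v. (\<lambda>w. g w * normalized_kernel m v w) \<in> (\<Union>q\<in>{1..}. Lspace q m))}"

definition hankel_integrand ::
    "nat \<Rightarrow> (complex \<Rightarrow> complex) \<Rightarrow> (complex \<Rightarrow> complex) \<Rightarrow> complex \<Rightarrow> complex \<Rightarrow> complex" where
  "hankel_integrand m g f z v =
     (g z - g v) * f v * cnj (kernel m z v) * of_real (cmod v ^ (2 * m) * exp (- (cmod v)\<^sup>2))"

definition hankel_domain :: "real \<Rightarrow> nat \<Rightarrow> (complex \<Rightarrow> complex) \<Rightarrow> (complex \<Rightarrow> complex) set" where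
  "hankel_domain p m g =
     {f \<in> Fock_Sobolev p m. AE z in lebesgue. integrable lebesgue (hankel_integrand m g f z)}"

definition hankel ::
    "nat \<Rightarrow> (complex \<Rightarrow> complex) \<Rightarrow> (complex \<Rightarrow> complex) \<Rightarrow> complex \<Rightarrow> complex" where
  "hankel m g f z =
     of_real (1 / (pi * fact m)) * (LINT v|lebesgue. hankel_integrand m g f z v)"

text \<open>
  A linear operator \<open>T\<close> given on a subspace \<open>D\<close> of the Fock-Sobolev space is a compact operator
  from \<open>Fock_Sobolev p m\<close> to \<open>Lspace p m\<close> if it is defined on the whole space, takes values in
  \<open>Lspace p m\<close>, and sends every bounded sequence to one with a norm-convergent subsequence.
\<close>

definition compact_operator :: "real \<Rightarrow> nat \<Rightarrow> (complex \<Rightarrow> complex) set \<Rightarrow>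
    ((complex \<Rightarrow> complex) \<Rightarrow> complex \<Rightarrow> complex) \<Rightarrow> bool" where
  "compact_operator p m D T \<longleftrightarrow>
     D = Fock_Sobolev p m \<and>
     (\<forall>f\<in>D. T f \<in> Lspace p m) \<and>
     (\<forall>f C. (\<forall>n. f n \<in> D \<and> Lnorm p m (f n) \<le> C) \<longrightarrow>
        (\<exists>h\<in>Lspace p m. \<exists>s::nat \<Rightarrow> nat. strict_mono s \<and>
           (\<lambda>n. Lnorm p m (\<lambda>z. T (f (s n)) z - h z)) \<longlonglongrightarrow> 0))"

definition Lp_loc :: "real \<Rightarrow> (complex \<Rightarrow> complex) set" where
  "Lp_loc p = {g. g \<in> borel_measurable lebesgue \<and>
     (\<forall>K. compact K \<longrightarrow> set_integrable lebesgue K (\<lambda>v. cmod (g v) powr p))}"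

definition ball_average :: "real \<Rightarrow> (complex \<Rightarrow> complex) \<Rightarrow> complex \<Rightarrow> complex" where
  "ball_average r g z = of_real (1 / (pi * r\<^sup>2)) * (LINT v:cball z r|lebesgue. g v)"

definition mean_oscillation :: "real \<Rightarrow> real \<Rightarrow> (complex \<Rightarrow> complex) \<Rightarrow> complex \<Rightarrow> real" where
  "mean_oscillation p r g z =
     (1 / (pi * r\<^sup>2) *
        (LINT v:cball z r|lebesgue. cmod (g v - ball_average r g z) powr p)) powr (1 / p)"

definition VMO_r :: "real \<Rightarrow> real \<Rightarrow> (complex \<Rightarrow> complex) set" where
  "VMO_r p r = {g \<in> Lp_loc p. (mean_oscillation p r g \<longlongrightarrow> 0) at_infinity}"

text \<open>
  The space \<open>VMO_r p r\<close> is the same for all \<open>r > 0\<close>; the union avoids singling out a radius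
  and makes membership for one radius sufficient.
\<close>

definition VMO :: "real \<Rightarrow> (complex \<Rightarrow> complex) set" where
  "VMO p = (\<Union>r\<in>{0<..}. VMO_r p r)"

end

theory Submission imports Defs begin

text \<open>
  The Gaussian decay of the kernel reduces everything to the oscillation of \<open>g\<close> at unit scale.
  Write \<open>U(v) = |f(v)| |v|^m exp(-|v|^2/2)\<close>, so that the \<open>L^{p,m}\<close> norm of \<open>f\<close> is, up to a
  constant, the plain \<open>L^p\<close> norm of \<open>U\<close>.  The identity
  \<open>w^m K(w) = m! (exp w - (Taylor polynomial of degree < m))\<close> for the kernel series \<open>K\<close> gives
  \<open>|z|^m |v|^m |K_z(v)| exp(-(|z|^2+|v|^2)/2) \<le> C exp(-|z-v|^2/8)\<close> for all \<open>z\<close> and \<open>v\<close>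
  (\<open>kernel_weighted_le\<close>).  Hence the weighted modulus of \<open>H_g f\<close> at \<open>z\<close> is at most a constant times
  \<open>\<integral> |g(z)-g(v)| U(v) exp(-|z-v|^2/8) dA(v)\<close>, and a form of Jensen's inequality bounds its \<open>p\<close>-th
  power by the same integral with \<open>|g(z)-g(v)|^p U(v)^p\<close>.

  Since \<open>f\<close> is entire, \<open>U(v)^p\<close> is at most a constant times its mean over the disc of radius \<open>r\<close> about \<open>v\<close>
  (\<open>fock_modulus_powr_le_integral\<close>).  Inserting this and exchanging the order of integration yields
  \<open>\<parallel>H_g f\<parallel>^p \<le> C \<integral> U(w)^p \<Psi>(w) dA(w)\<close>  (\<open>hankel_norm_bound\<close>), where
  \<open>\<Psi>(w) = \<integral>_{|v-w| \<le> r} \<integral> |g(z)-g(v)|^p exp(-|z-v|^2/8) dA(z) dA(v)\<close>.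

  For \<open>g\<close> of vanishing mean oscillation, \<open>\<Psi>\<close> is bounded and tends to \<open>0\<close> at infinity: averages over
  nearby discs differ by at most a multiple of the oscillation, so chaining makes the averages of
  \<open>g\<close> grow at most quadratically away from \<open>w\<close>, with a factor that tends to \<open>0\<close> as \<open>|w|\<close> grows, and
  the Gaussian absorbs polynomial growth (\<open>local_oscillation_le\<close>).

  Boundedness of \<open>\<Psi>\<close> shows that \<open>H_g\<close> is defined and bounded on the whole space.  For compactness,
  Montel's theorem extracts from a bounded sequence a subsequence \<open>f_n \<rightarrow> h\<close> that converges locally
  uniformly, and \<open>h\<close> is in the space by Fatou's lemma.  Applied to \<open>f_n - h\<close>, the norm bound tends
  to \<open>0\<close>: on a large disc the functions are uniformly small, and outside it \<open>\<Psi>\<close> is small.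
  The mean oscillation is invariant under complex conjugation, so \<open>H_{\bar g}\<close> is covered as well.
\<close>

section \<open>Measurability and elementary inequalities\<close>

lemma sigma_finite_lebesgue: "sigma_finite_measure (lebesgue :: 'a::euclidean_space measure)"
proof
  obtain A :: "'a set set" where A: "countable A" "A \<subseteq> sets lborel" "\<Union>A = space lborel"
      "\<forall>a\<in>A. emeasure lborel a \<noteq> \<infinity>"
    using lborel.sigma_finite_countable by blast
  then show "\<exists>A::'a set set. countable A \<and> A \<subseteq> sets lebesgue \<and> \<Union> A = space lebesgue \<and> (\<forall>a\<in>A. emeasure lebesgue a \<noteq> \<infinity>)"
    by (intro exI[of _ A]) (auto)
qed

interpretation lebesgue_pair:
  pair_sigma_finite "lebesgue :: complex measure" "lebesgue :: complex measure"
  by (simp add: pair_sigma_finite_def sigma_finite_lebesgue)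

text \<open>
  The symbol is only Lebesgue measurable, so all double integrals are taken over the product of two
  copies of \<open>lebesgue\<close>.  The next three rules let Borel functions of the two variables be recognised as
  measurable there.
\<close>

lemma measurable_lebesgue_borel [measurable]:
  "(\<lambda>x. x) \<in> measurable lebesgue (borel :: 'a::euclidean_space measure)"
  by (intro measurable_completion) simp

lemma measurable_fst_borel [measurable]:
  "fst \<in> measurable (lebesgue \<Otimes>\<^sub>M M) (borel :: 'a::euclidean_space measure)"
  by (rule measurable_compose[OF measurable_fst measurable_lebesgue_borel])

lemma measurable_snd_borel [measurable]:
  "snd \<in> measurable (M \<Otimes>\<^sub>M lebesgue) (borel :: 'a::euclidean_space measure)"
  by (rule measurable_compose[OF measurable_snd measurable_lebesgue_borel])

lemma measurable_cnj [measurable]: "cnj \<in> borel_measurable borel"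
  by (intro borel_measurable_continuous_onI continuous_intros)

lemma pred_cball [measurable]: "Measurable.pred lebesgue (\<lambda>v. v \<in> cball (z::complex) s)"
  by (simp add: pred_def)

lemma powr_add_le:
  fixes a b p :: real
  assumes "0 \<le> a" "0 \<le> b" "0 \<le> p"
  shows "(a + b) powr p \<le> 2 powr p * (a powr p + b powr p)"
proof -
  have "(a + b) powr p \<le> (2 * max a b) powr p"
    using assms by (intro powr_mono2) auto
  also have "\<dots> = 2 powr p * max a b powr p"
    using assms by (simp add: powr_mult)
  also have "\<dots> \<le> 2 powr p * (a powr p + b powr p)"
    by (intro mult_left_mono) (auto simp: max_def)
  finally show ?thesis .
qed

text \<open>
  A linearisation of \<open>t \<mapsto> t\<close> against \<open>t^p\<close>: if \<open>t > s\<close>, then \<open>t = t^p t^{1-p} \<le> t^p s^{1-p}\<close>.  Integrating it and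
  optimising over \<open>s\<close> gives Jensen's inequality up to a factor \<open>2\<close>.
\<close>

lemma le_add_powr_mult:
  fixes s t p :: real
  assumes "0 \<le> t" "0 < s" "1 \<le> p"
  shows "t \<le> s + t powr p * s powr (1 - p)"
proof (cases "t \<le> s")
  case False
  then have "1 \<le> (t / s) powr (p - 1)"
    using assms by (intro ge_one_powr_ge_zero) auto
  then have "t \<le> t * (t / s) powr (p - 1)"
    using assms by (simp add: mult_le_cancel_left1)
  also have "\<dots> = t powr p * s powr (1 - p)"
    using assms False by (simp add: powr_divide powr_diff field_simps)
  finally show ?thesis using assms by simp
qed (use assms in \<open>auto intro: add_increasing2\<close>)

lemma nn_integral_powr_Jensen:
  fixes h w :: "'a \<Rightarrow> real"
  assumes [measurable]: "h \<in> borel_measurable M" "w \<in> borel_measurable M"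
    and nn: "\<And>x. 0 \<le> h x" "\<And>x. 0 \<le> w x"
    and p: "1 \<le> p" and W: "0 < W" and I: "0 \<le> I"
    and intW: "(\<integral>\<^sup>+x. ennreal (w x) \<partial>M) \<le> ennreal W"
    and intI: "(\<integral>\<^sup>+x. ennreal (h x powr p * w x) \<partial>M) \<le> ennreal I"
  shows "(\<integral>\<^sup>+x. ennreal (h x * w x) \<partial>M) \<le> ennreal (2 * W powr (1 - 1 / p) * I powr (1 / p))"
proof -
  have bound: "(\<integral>\<^sup>+x. ennreal (h x * w x) \<partial>M) \<le> ennreal (s * W + s powr (1 - p) * I)" if "0 < s" for s
  proof -
    have "(\<integral>\<^sup>+x. ennreal (h x * w x) \<partial>M) \<le>
        (\<integral>\<^sup>+x. ennreal s * ennreal (w x) + ennreal (s powr (1 - p)) * ennreal (h x powr p * w x) \<partial>M)"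
    proof (rule nn_integral_mono)
      fix x
      have "h x * w x \<le> (s + h x powr p * s powr (1 - p)) * w x"
        using le_add_powr_mult[of "h x" s p] nn that p by (intro mult_right_mono) auto
      then show "ennreal (h x * w x) \<le> ennreal s * ennreal (w x) + ennreal (s powr (1 - p)) * ennreal (h x powr p * w x)"
        using that nn by (simp add: ennreal_mult[symmetric] ennreal_plus[symmetric] ennreal_leI algebra_simps del: ennreal_plus)
    qed
    also have "\<dots> = ennreal s * (\<integral>\<^sup>+x. ennreal (w x) \<partial>M) + ennreal (s powr (1 - p)) * (\<integral>\<^sup>+x. ennreal (h x powr p * w x) \<partial>M)"
      by (simp add: nn_integral_add nn_integral_cmult)
    also have "\<dots> \<le> ennreal s * ennreal W + ennreal (s powr (1 - p)) * ennreal I"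
      by (intro add_mono mult_left_mono intW intI) auto
    also have "\<dots> = ennreal (s * W + s powr (1 - p) * I)"
      using that W I by (simp add: ennreal_mult[symmetric])
    finally show ?thesis .
  qed
  show ?thesis
  proof (cases "I = 0")
    case True
    \<comment> \<open>here no \<open>s\<close> balances the terms; let it tend to \<open>0\<close>\<close>
    have "(\<integral>\<^sup>+x. ennreal (h x * w x) \<partial>M) \<le> 0"
    proof (rule ennreal_le_epsilon)
      fix e :: real assume "0 < e"
      then show "(\<integral>\<^sup>+x. ennreal (h x * w x) \<partial>M) \<le> 0 + ennreal e"
        using bound[of "e / W"] W True by simp
    qed
    then show ?thesis by (metis order_trans zero_le)
  next
    case False
    \<comment> \<open>the value of \<open>s\<close> at which both terms of the bound agree\<close>
    define s where "s = (I / W) powr (1 / p)"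
    have s: "0 < s" using False I W by (simp add: s_def)
    have "s powr p = I / W" using p I W by (simp add: s_def powr_powr)
    then have "s powr (1 - p) * I = s * W"
      using s False I W by (simp add: powr_diff field_simps)
    moreover have "s * W = W powr (1 - 1 / p) * I powr (1 / p)"
      using W I by (simp add: s_def powr_divide powr_diff field_simps)
    ultimately have "s * W + s powr (1 - p) * I = 2 * W powr (1 - 1 / p) * I powr (1 / p)" by linarith
    then show ?thesis using bound[OF s] by simp
  qed
qed

section \<open>Gaussian integrals over the plane\<close>

lemma emeasure_cball_complex:
  "0 \<le> r \<Longrightarrow> emeasure lborel (cball (z :: complex) r) = ennreal (pi * r\<^sup>2)"
  by (simp add: emeasure_cball unit_ball_vol_2)

text \<open>
  A crude one-dimensional majorant; its product over the two coordinates dominates all Gaussian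
  moments in the plane.
\<close>

lemma nn_integral_exp_abs: "(\<integral>\<^sup>+x. ennreal (exp (- \<bar>x\<bar>)) \<partial>lborel) \<le> 2"
proof -
  have 1: "(\<integral>\<^sup>+x. ennreal (exp (- x)) * indicator {0..} x \<partial>lborel) = ennreal (0 - (- exp (- 0)))"
    proof (rule nn_integral_FTC_atLeast)
    have "((\<lambda>x. - exp (- x :: real)) \<longlongrightarrow> - 0) at_top"
      by (intro tendsto_minus filterlim_compose[OF exp_at_bot] filterlim_uminus_at_bot_at_top)
    then show "((\<lambda>x. - exp (- x :: real)) \<longlongrightarrow> 0) at_top" by simp
  qed (auto intro!: derivative_eq_intros)
  have 2: "(\<integral>\<^sup>+x. ennreal (exp x) * indicator {0..} (- x) \<partial>lborel) = (\<integral>\<^sup>+x. ennreal (exp (- x)) * indicator {0..} x \<partial>lborel)"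
    by (subst nn_integral_real_affine[where c="-1" and t=0]) auto
  have "(\<integral>\<^sup>+x. ennreal (exp (- \<bar>x\<bar>)) \<partial>lborel) \<le>
     (\<integral>\<^sup>+x. ennreal (exp (- x)) * indicator {0..} x + ennreal (exp x) * indicator {0..} (- x) \<partial>lborel)"
    by (intro nn_integral_mono) (auto simp: indicator_def)
  also have "\<dots> = (\<integral>\<^sup>+x. ennreal (exp (- x)) * indicator {0..} x \<partial>lborel) + (\<integral>\<^sup>+x. ennreal (exp x) * indicator {0..} (- x) \<partial>lborel)"
    by (rule nn_integral_add) auto
  also have "\<dots> = 2" unfolding 2 1 by simp
  finally show ?thesis .
qed

lemma nn_integral_lebesgue_shift:
  fixes w :: complex
  assumes [measurable]: "f \<in> borel_measurable borel"
  shows "(\<integral>\<^sup>+z. f (z - w) \<partial>lebesgue) = (\<integral>\<^sup>+z. f z \<partial>lborel)"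
proof -
  have "(\<integral>\<^sup>+z. f z \<partial>lborel) = (\<integral>\<^sup>+z. f z \<partial>distr lborel borel ((+) (- w)))"
    by (simp add: lborel_distr_plus)
  also have "\<dots> = (\<integral>\<^sup>+z. f (z - w) \<partial>lborel)"
    by (subst nn_integral_distr) auto
  finally show ?thesis by (simp add: nn_integral_completion)
qed

lemma nn_integral_gaussian_moment:
  fixes c k :: real
  assumes "0 < c"
  obtains B where "0 < B" "\<And>w. (\<integral>\<^sup>+z. ennreal ((1 + cmod (z - w)) powr k * exp (- c * (cmod (z - w))\<^sup>2)) \<partial>lebesgue) \<le> ennreal B"
proof -
  define A where "A = exp ((\<bar>k\<bar> + 2)\<^sup>2 / (4 * c))"
  define q where "q = (\<lambda>t. (1 + t) powr k * exp (- c * t\<^sup>2) * exp (2 * t))"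
  \<comment> \<open>\<open>1 + t \<le> exp t\<close>; the constant comes from completing the square in the exponent.\<close>
  have A: "q t \<le> A" if "0 \<le> t" for t
  proof -
    have "(1 + t) powr k \<le> (1 + t) powr \<bar>k\<bar>"
      using that by (intro powr_mono) auto
    also have "\<dots> \<le> exp t powr \<bar>k\<bar>"
      using that by (intro powr_mono2) (auto simp: exp_ge_add_one_self)
    also have "\<dots> = exp (\<bar>k\<bar> * t)" by (simp add: exp_powr_real mult.commute)
    finally have "q t \<le> exp (\<bar>k\<bar> * t) * exp (- c * t\<^sup>2) * exp (2 * t)"
      unfolding q_def by (intro mult_right_mono) auto
    also have "\<dots> = exp (\<bar>k\<bar> * t - c * t\<^sup>2 + 2 * t)"
      by (simp flip: exp_add)
    also have "\<bar>k\<bar> * t - c * t\<^sup>2 + 2 * t = (\<bar>k\<bar> + 2)\<^sup>2 / (4 * c) - c * (t - (\<bar>k\<bar> + 2) / (2 * c))\<^sup>2"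
      using assms by (simp add: field_simps power2_eq_square)
    also have "exp \<dots> \<le> A"
      using assms by (simp add: A_def)
    finally show ?thesis .
  qed
  have le: "(1 + cmod z) powr k * exp (- c * (cmod z)\<^sup>2) \<le> A * (\<Prod>b\<in>Basis. exp (- \<bar>z \<bullet> b\<bar>))" for z
  proof -
    have "(1 + cmod z) powr k * exp (- c * (cmod z)\<^sup>2) = q (cmod z) * exp (- 2 * cmod z)"
      by (simp add: q_def mult.assoc flip: exp_add)
    also have "\<dots> \<le> A * (\<Prod>b\<in>Basis. exp (- \<bar>z \<bullet> b\<bar>))"
    proof (rule mult_mono)
      show "exp (- 2 * cmod z) \<le> (\<Prod>b\<in>Basis. exp (- \<bar>z \<bullet> b\<bar>))"
        using abs_Re_le_cmod[of z] abs_Im_le_cmod[of z]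
        by (simp add: Basis_complex_def inner_complex_def flip: exp_add)
    qed (use A in \<open>auto simp: A_def\<close>)
    finally show ?thesis .
  qed
  have "(\<integral>\<^sup>+z. ennreal ((1 + cmod (z - w)) powr k * exp (- c * (cmod (z - w))\<^sup>2)) \<partial>lebesgue) \<le> ennreal (4 * A)" for w
  proof -
    have "(\<integral>\<^sup>+z. ennreal ((1 + cmod (z - w)) powr k * exp (- c * (cmod (z - w))\<^sup>2)) \<partial>lebesgue) =
        (\<integral>\<^sup>+z. ennreal ((1 + cmod z) powr k * exp (- c * (cmod z)\<^sup>2)) \<partial>lborel)"
      by (rule nn_integral_lebesgue_shift) measurable
    also have "\<dots> \<le> (\<integral>\<^sup>+z. ennreal A * (\<Prod>b\<in>Basis. ennreal (exp (- \<bar>z \<bullet> b\<bar>))) \<partial>(lborel :: complex measure))"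
      using le by (intro nn_integral_mono) (simp add: A_def prod_ennreal ennreal_mult[symmetric] prod_nonneg ennreal_leI)
    also have "\<dots> = ennreal A * (\<integral>\<^sup>+z. (\<Prod>b\<in>Basis. ennreal (exp (- \<bar>z \<bullet> b\<bar>))) \<partial>(lborel :: complex measure))"
      by (rule nn_integral_cmult) auto
    also have "(\<integral>\<^sup>+z. (\<Prod>b\<in>Basis. ennreal (exp (- \<bar>z \<bullet> b\<bar>))) \<partial>(lborel :: complex measure))
       = (\<Prod>b\<in>(Basis :: complex set). \<integral>\<^sup>+x. ennreal (exp (- \<bar>x\<bar>)) \<partial>lborel)"
      by (rule nn_integral_lborel_prod) auto
    also have "\<dots> \<le> 2 * 2"
      using mult_mono[OF nn_integral_exp_abs nn_integral_exp_abs] by (simp add: Basis_complex_def)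
    finally show ?thesis
      by (simp add: A_def ennreal_mult mult.commute[of 4] mult_left_mono)
  qed
  then show ?thesis using that[of "4 * A"] by (auto simp: A_def)
qed

section \<open>Mean oscillation and the growth of averages\<close>

locale local_Lp =
  fixes p r :: real and g :: "complex \<Rightarrow> complex"
  assumes p_ge_1: "1 \<le> p" and r_pos: "0 < r" and g_Lp_loc: "g \<in> Lp_loc p"
begin

abbreviation avg :: "complex \<Rightarrow> complex" where "avg \<equiv> ball_average r g"

abbreviation osc :: "complex \<Rightarrow> real" where "osc \<equiv> mean_oscillation p r g"

lemma measurable_g [measurable]: "g \<in> borel_measurable lebesgue"
  using g_Lp_loc by (simp add: Lp_loc_def)

lemma set_integrable_powr: "set_integrable lebesgue (cball z s) (\<lambda>v. cmod (g v) powr p)"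
  using g_Lp_loc by (simp add: Lp_loc_def)

lemma set_integrable_const: "set_integrable lebesgue (cball (z::complex) s) (\<lambda>v. c::real)"
  unfolding set_integrable_def
  by (cases "0 \<le> s") (auto intro!: integrable_real_mult_indicator simp: emeasure_cball_complex integrable_indicator_iff)

lemma powr_norm_diff_le: "cmod (g v - a) powr p \<le> 2 powr p * (cmod (g v) powr p + cmod a powr p)"
proof -
  have "cmod (g v - a) powr p \<le> (cmod (g v) + cmod a) powr p"
    using p_ge_1 by (intro powr_mono2 norm_triangle_ineq4) auto
  also have "\<dots> \<le> 2 powr p * (cmod (g v) powr p + cmod a powr p)"
    using p_ge_1 by (intro powr_add_le) auto
  finally show ?thesis .
qed

lemma set_integrable_powr_diff:
  "set_integrable lebesgue (cball z s) (\<lambda>v. cmod (g v - a) powr p)"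
proof (rule set_integrable_bound)
  show "set_integrable lebesgue (cball z s) (\<lambda>v. 2 powr p * (cmod (g v) powr p + cmod a powr p))"
    by (intro set_integrable_mult_right set_integral_add set_integrable_powr set_integrable_const)
  show "set_borel_measurable lebesgue (cball z s) (\<lambda>v. cmod (g v - a) powr p)"
    unfolding set_borel_measurable_def by measurable
  show "AE v in lebesgue. v \<in> cball z s \<longrightarrow> norm (cmod (g v - a) powr p) \<le> norm (2 powr p * (cmod (g v) powr p + cmod a powr p))"
    using powr_norm_diff_le by (auto intro!: always_eventually order_trans[OF powr_norm_diff_le])
qed

lemma set_integrable_g: "set_integrable lebesgue (cball z s) g"
proof (rule set_integrable_bound)
  show "set_integrable lebesgue (cball z s) (\<lambda>v. 1 + cmod (g v) powr p)"
    by (intro set_integral_add set_integrable_powr set_integrable_const)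
  show "set_borel_measurable lebesgue (cball z s) g"
    unfolding set_borel_measurable_def by measurable
  have "t \<le> 1 + t powr p" if "0 \<le> t" for t :: real
    using le_add_powr_mult[of t 1 p] that p_ge_1 by simp
  then show "AE v in lebesgue. v \<in> cball z s \<longrightarrow> norm (g v) \<le> norm (1 + cmod (g v) powr p)"
    by (auto intro!: always_eventually)
qed

lemma osc_nonneg: "0 \<le> osc z"
  by (simp add: mean_oscillation_def)

lemma nn_integral_osc:
  "(\<integral>\<^sup>+v. ennreal (cmod (g v - avg z) powr p * indicator (cball z r) v) \<partial>lebesgue)
     = ennreal (pi * r\<^sup>2 * osc z powr p)"
proof -
  let ?I = "LINT v:cball z r|lebesgue. cmod (g v - avg z) powr p"
  have nn: "0 \<le> ?I"
    unfolding set_lebesgue_integral_def by (intro integral_nonneg_AE) auto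
  have "(\<integral>\<^sup>+v. ennreal (cmod (g v - avg z) powr p * indicator (cball z r) v) \<partial>lebesgue) = ennreal ?I"
    using nn_integral_eq_integral[OF set_integrable_powr_diff[unfolded set_integrable_def, of z r "avg z"]]
    by (simp add: set_lebesgue_integral_def mult.commute)
  also have "?I = pi * r\<^sup>2 * osc z powr p"
    using r_pos nn p_ge_1 by (simp add: mean_oscillation_def powr_powr)
  finally show ?thesis .
qed

lemma measurable_avg [measurable]: "avg \<in> borel_measurable lebesgue"
proof -
  have *: "(\<lambda>x. LINT v|lebesgue. (if dist x v \<le> r then g v else 0)) \<in> borel_measurable lebesgue"
    by (rule sigma_finite_measure.borel_measurable_lebesgue_integral[OF sigma_finite_lebesgue]) measurable
  have "avg = (\<lambda>x. of_real (1 / (pi * r\<^sup>2)) * (LINT v|lebesgue. (if dist x v \<le> r then g v else 0)))"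
    by (auto simp: fun_eq_iff ball_average_def set_lebesgue_integral_def intro!: Bochner_Integration.integral_cong)
  then show ?thesis using * by simp
qed

text \<open>
  The mean oscillation is known to be small only near infinity; over a bounded set of centres it is
  controlled by the integral of \<open>|g|^p\<close> over one large disc.
\<close>

lemma osc_bounded_cball: "\<exists>B. \<forall>z\<in>cball 0 R. osc z \<le> B"
proof -
  define P where "P = (LINT v:cball 0 (R + r)|lebesgue. cmod (g v) powr p)"
  define A where "A = 1 / (pi * r\<^sup>2)"
  have A: "0 < A" using r_pos by (simp add: A_def)
  define D where "D = 1 + A * P"
  have "osc z \<le> (A * (2 powr p * (P + D powr p * (pi * r\<^sup>2)))) powr (1 / p)" if z: "z \<in> cball 0 R" for z
  proof -
    have sub: "cball z r \<subseteq> cball 0 (R + r)"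
      using z by (subst cball_subset_cball_iff) (auto simp: dist_norm)
    have mono: "(LINT v:cball z r|lebesgue. cmod (g v) powr p) \<le> P"
      unfolding P_def set_lebesgue_integral_def
      using set_integrable_powr[of z r] set_integrable_powr[of 0 "R + r"] sub
      unfolding set_integrable_def by (intro integral_mono) (auto simp: indicator_def)
    have len: "(LINT v:cball z r|lebesgue. c) = c * (pi * r\<^sup>2)" for c :: real
      using r_pos by (simp add: set_lebesgue_integral_def measure_def emeasure_cball_complex)
    have "cmod (avg z) \<le> A * (LINT v:cball z r|lebesgue. cmod (g v))"
      using r_pos set_integral_norm_bound[OF set_integrable_g[of z r]]
      by (simp add: ball_average_def norm_mult A_def norm_divide norm_power divide_right_mono)
    also have "(LINT v:cball z r|lebesgue. cmod (g v)) \<le> (LINT v:cball z r|lebesgue. 1 + cmod (g v) powr p)"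
    proof (intro set_integral_mono set_integral_add set_integrable_const set_integrable_powr set_integrable_norm set_integrable_g)
      show "cmod (g v) \<le> 1 + cmod (g v) powr p" for v
        using le_add_powr_mult[of "cmod (g v)" 1 p] p_ge_1 by simp
    qed
    also have "\<dots> = pi * r\<^sup>2 + (LINT v:cball z r|lebesgue. cmod (g v) powr p)"
      by (simp add: set_integral_add set_integrable_const set_integrable_powr len del: set_integral_const)
    also have "\<dots> \<le> pi * r\<^sup>2 + P" using mono by simp
    also have "A * (pi * r\<^sup>2 + P) = D"
      using r_pos by (simp add: D_def A_def field_simps)
    finally have avg_le: "cmod (avg z) \<le> D" using A by simp
    have "(LINT v:cball z r|lebesgue. cmod (g v - avg z) powr p) \<le>
        (LINT v:cball z r|lebesgue. 2 powr p * (cmod (g v) powr p + D powr p))"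
    proof (intro set_integral_mono set_integrable_powr_diff set_integrable_mult_right set_integral_add set_integrable_powr set_integrable_const)
      fix v
      have "cmod (avg z) powr p \<le> D powr p"
        using avg_le p_ge_1 by (intro powr_mono2) auto
      then show "cmod (g v - avg z) powr p \<le> 2 powr p * (cmod (g v) powr p + D powr p)"
        by (intro order_trans[OF powr_norm_diff_le] mult_left_mono add_left_mono) auto
    qed
    also have "\<dots> = 2 powr p * ((LINT v:cball z r|lebesgue. cmod (g v) powr p) + D powr p * (pi * r\<^sup>2))"
      by (simp add: set_integral_add set_integrable_const set_integrable_powr len del: set_integral_const)
    also have "\<dots> \<le> 2 powr p * (P + D powr p * (pi * r\<^sup>2))"
      using mono by (intro mult_left_mono) auto
    finally show ?thesis
      unfolding mean_oscillation_def A_def[symmetric] using A p_ge_1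
      by (intro powr_mono2 mult_left_mono)
        (auto simp: set_lebesgue_integral_def intro!: mult_nonneg_nonneg integral_nonneg_AE)
  qed
  then show ?thesis by blast
qed

text \<open>
  Both discs contain the disc of half the radius about the midpoint of their centres, which occupies a
  quarter of the area; on it \<open>g\<close> is close to both averages.
\<close>

lemma avg_diff_le:
  assumes xy: "dist x y \<le> r"
  shows "cmod (avg x - avg y) \<le> 16 * (osc x + osc y)"
proof -
  define B where "B = cball ((x + y) / 2) (r / 2)"
  define a where "a = cmod (avg x - avg y)"
  define S where "S = osc x + osc y"
  have "cball c (r / 2) \<subseteq> cball z r" if "dist c z \<le> r / 2" for c z :: complex
    using that by (simp add: cball_subset_cball_iff dist_commute)
  moreover have "dist ((x + y) / 2) x \<le> r / 2" "dist ((x + y) / 2) y \<le> r / 2"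
  proof -
    have "(x + y) / 2 - x = (y - x) / 2" "(x + y) / 2 - y = (x - y) / 2"
      by (simp_all add: field_simps)
    then have "cmod ((x + y) / 2 - x) = cmod (x - y) / 2" "cmod ((x + y) / 2 - y) = cmod (x - y) / 2"
      by (simp_all only: norm_divide norm_minus_commute[of y x]) simp_all
    then show "dist ((x + y) / 2) x \<le> r / 2" "dist ((x + y) / 2) y \<le> r / 2"
      using xy unfolding dist_norm by simp_all
  qed
  ultimately have Bx: "B \<subseteq> cball x r" and By: "B \<subseteq> cball y r"
    unfolding B_def by blast+
  have [measurable]: "B \<in> sets lebesgue" by (simp add: B_def)
  have "ennreal (a powr p * (pi * (r / 2)\<^sup>2)) = (\<integral>\<^sup>+v. ennreal (a powr p) * indicator B v \<partial>lebesgue)"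
    using r_pos by (simp add: nn_integral_cmult_indicator B_def emeasure_cball_complex ennreal_mult del: power_divide)
  also have "\<dots> \<le> (\<integral>\<^sup>+v. ennreal (2 powr p) * (ennreal (cmod (g v - avg x) powr p * indicator (cball x r) v)
       + ennreal (cmod (g v - avg y) powr p * indicator (cball y r) v)) \<partial>lebesgue)"
  proof (intro nn_integral_mono)
    fix v
    have "a \<le> cmod (g v - avg x) + cmod (g v - avg y)" unfolding a_def by norm
    then have "a powr p \<le> (cmod (g v - avg x) + cmod (g v - avg y)) powr p"
      using p_ge_1 by (intro powr_mono2) (auto simp: a_def)
    also have "\<dots> \<le> 2 powr p * (cmod (g v - avg x) powr p + cmod (g v - avg y) powr p)"
      using p_ge_1 by (intro powr_add_le) auto
    finally have *: "a powr p \<le> 2 powr p * (cmod (g v - avg x) powr p + cmod (g v - avg y) powr p)" .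
    show "ennreal (a powr p) * indicator B v \<le> ennreal (2 powr p) * (ennreal (cmod (g v - avg x) powr p * indicator (cball x r) v)
       + ennreal (cmod (g v - avg y) powr p * indicator (cball y r) v))"
    proof (cases "v \<in> B")
      case True
      then have "v \<in> cball x r" "v \<in> cball y r" using Bx By by auto
      then show ?thesis using * True
        by (simp add: ennreal_mult[symmetric] ennreal_plus[symmetric] ennreal_leI del: ennreal_plus)
    qed simp
  qed
  also have "\<dots> = ennreal (2 powr p) * ((\<integral>\<^sup>+v. ennreal (cmod (g v - avg x) powr p * indicator (cball x r) v) \<partial>lebesgue)
       + (\<integral>\<^sup>+v. ennreal (cmod (g v - avg y) powr p * indicator (cball y r) v) \<partial>lebesgue))"
    by (subst nn_integral_cmult) (auto simp: nn_integral_add)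
  also have "\<dots> = ennreal (2 powr p * (pi * r\<^sup>2 * (osc x powr p + osc y powr p)))"
    by (simp add: nn_integral_osc ennreal_mult[symmetric] ennreal_plus[symmetric] distrib_left del: ennreal_plus)
  finally have "a powr p * (pi * (r / 2)\<^sup>2) \<le> 2 powr p * (pi * r\<^sup>2 * (osc x powr p + osc y powr p))"
    by (subst (asm) ennreal_le_iff) auto
  then have "a powr p * (pi * r\<^sup>2) \<le> (4 * (2 powr p * (osc x powr p + osc y powr p))) * (pi * r\<^sup>2)"
    by (simp add: power_divide algebra_simps)
  then have "a powr p \<le> 4 * (2 powr p * (osc x powr p + osc y powr p))"
    using r_pos by (subst (asm) mult_le_cancel_right) auto
  also have "\<dots> \<le> 4 * (2 powr p * (S powr p + S powr p))"
    using p_ge_1 osc_nonneg[of x] osc_nonneg[of y]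
    by (intro mult_left_mono add_mono powr_mono2) (auto simp: S_def)
  also have "\<dots> = 8 * (2 powr p * S powr p)" by simp
  also have "\<dots> \<le> 8 powr p * (2 powr p * S powr p)"
    using powr_mono[of 1 p "8::real"] p_ge_1 by (intro mult_right_mono) auto
  also have "\<dots> = (16 * S) powr p"
    using osc_nonneg[of x] osc_nonneg[of y] by (simp add: powr_mult[symmetric] S_def)
  finally have "a powr p \<le> (16 * S) powr p" .
  moreover have "0 \<le> S" "0 \<le> a"
    using osc_nonneg[of x] osc_nonneg[of y] by (auto simp: S_def a_def)
  ultimately show ?thesis
    using p_ge_1 powr_less_mono2[of p "16 * S" a] unfolding a_def S_def by fastforce
qed

text \<open>
  The segment from \<open>w\<close> to \<open>w + x\<close> is cut into about \<open>|x|/r\<close> steps of length at most \<open>r\<close>, and each step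
  changes the average by at most a multiple of \<open>\<epsilon> (1 + |x|)\<close>.  The hypothesis allows the oscillation to grow linearly so that one
  inequality describes both decay near \<open>w\<close> and mere boundedness far away from \<open>w\<close>.
\<close>

lemma avg_growth:
  assumes \<epsilon>: "\<And>x. osc (w + x) \<le> \<epsilon> * (1 + cmod x)"
  shows "cmod (avg (w + x) - avg w) \<le> 32 * (1 + 1 / r) * \<epsilon> * (1 + cmod x)\<^sup>2"
proof -
  define N where "N = Suc (nat \<lfloor>cmod x / r\<rfloor>)"
  have N: "cmod x / r \<le> real N" "real N \<le> 1 + cmod x / r" "0 < N"
    using r_pos by (auto simp: N_def) linarith+
  define y where "y = (\<lambda>k. w + of_real (real k / real N) * x)"
  have \<epsilon>0: "0 \<le> \<epsilon>" using \<epsilon>[of 0] osc_nonneg[of w] by simp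
  have y_norm: "cmod (y k - w) \<le> cmod x" if "k \<le> N" for k
    using that N by (auto simp: y_def norm_mult norm_divide field_simps intro!: mult_right_mono)
  have osc_y: "osc (y k) \<le> \<epsilon> * (1 + cmod x)" if "k \<le> N" for k
    using \<epsilon>[of "y k - w"] mult_left_mono[OF add_left_mono[OF y_norm[OF that], of 1] \<epsilon>0] by simp
  have step: "cmod (avg (y (Suc k)) - avg (y k)) \<le> 32 * \<epsilon> * (1 + cmod x)" if "k < N" for k
  proof -
    have "y (Suc k) - y k = of_real (1 / real N) * x"
      by (simp add: y_def add_divide_distrib distrib_right)
    then have "dist (y (Suc k)) (y k) = cmod x / real N"
      by (simp add: dist_norm norm_mult norm_divide)
    also have "\<dots> \<le> r" using N r_pos by (simp add: field_simps)
    finally have "cmod (avg (y (Suc k)) - avg (y k)) \<le> 16 * (osc (y (Suc k)) + osc (y k))"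
      by (rule avg_diff_le)
    also have "\<dots> \<le> 16 * (\<epsilon> * (1 + cmod x) + \<epsilon> * (1 + cmod x))"
      using that by (intro mult_left_mono add_mono osc_y) auto
    finally show ?thesis by simp
  qed
  have sum: "cmod (avg (y k) - avg (y 0)) \<le> real k * (32 * \<epsilon> * (1 + cmod x))" if "k \<le> N" for k
    using that
  proof (induction k)
    case (Suc k)
    have "cmod (avg (y (Suc k)) - avg (y 0)) \<le> cmod (avg (y (Suc k)) - avg (y k)) + cmod (avg (y k) - avg (y 0))"
      by norm
    then show ?case using Suc step[of k] by (simp add: distrib_right)
  qed simp
  have "cmod (avg (w + x) - avg w) \<le> real N * (32 * \<epsilon> * (1 + cmod x))"
    using sum[of N] N by (simp add: y_def)
  also have "\<dots> \<le> ((1 + 1 / r) * (1 + cmod x)) * (32 * \<epsilon> * (1 + cmod x))"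
  proof (rule mult_right_mono)
    have "(1 + 1 / r) * (1 + cmod x) = 1 + cmod x / r + (cmod x + 1 / r)"
      by (simp add: field_simps add_divide_distrib)
    moreover have "0 \<le> cmod x + 1 / r" using r_pos by simp
    ultimately show "real N \<le> (1 + 1 / r) * (1 + cmod x)" using N(2) by linarith
  qed (use \<epsilon>0 in simp)
  also have "\<dots> = 32 * (1 + 1 / r) * \<epsilon> * (1 + cmod x)\<^sup>2"
    by (simp only: power2_eq_square mult_ac)
  finally show ?thesis .
qed

end

lemma exp_gaussian_shift_le:
  fixes u v w :: complex
  assumes "0 \<le> c" "dist v w \<le> r"
  shows "exp (- c * (cmod (u - v))\<^sup>2) \<le> exp (c * r\<^sup>2) * exp (- (c / 2) * (cmod (u - w))\<^sup>2)"
proof -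
  have "cmod (u - w) \<le> cmod (u - v) + r"
    using assms norm_triangle_ineq[of "u - v" "v - w"] by (simp add: dist_norm)
  then have "(cmod (u - w))\<^sup>2 \<le> (cmod (u - v) + r)\<^sup>2"
    by (intro power_mono) auto
  also have "\<dots> \<le> 2 * (cmod (u - v))\<^sup>2 + 2 * r\<^sup>2"
    using sum_squares_bound[of "cmod (u - v)" r] by (simp add: power2_sum)
  finally have "c * (cmod (u - w))\<^sup>2 \<le> c * (2 * (cmod (u - v))\<^sup>2 + 2 * r\<^sup>2)"
    using assms by (intro mult_left_mono)
  then show ?thesis
    by (simp add: algebra_simps flip: exp_add)
qed

context local_Lp
begin

lemma osc_bounded:
  assumes "(osc \<longlongrightarrow> 0) at_infinity"
  obtains M where "0 < M" "\<And>z. osc z \<le> M"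
proof -
  have "eventually (\<lambda>z. osc z < 1) at_infinity"
    using assms by (rule order_tendstoD) simp
  then obtain R where R: "\<And>z. R \<le> cmod z \<Longrightarrow> osc z < 1"
    by (auto simp: eventually_at_infinity)
  obtain B where B: "\<And>z. z \<in> cball 0 R \<Longrightarrow> osc z \<le> B"
    using osc_bounded_cball by blast
  have "osc z \<le> max 1 B" for z
    using R[of z] B[of z] by (cases "R \<le> cmod z") (auto simp: max_def)
  then show ?thesis by (intro that[of "max 1 B"]) auto
qed

text \<open>
  For \<open>|x| \<le> |w|/2\<close> the point \<open>w + x\<close> is still far out, where the oscillation is below \<open>\<epsilon>\<close>; for larger
  \<open>x\<close> the factor \<open>|x|\<close> makes the right-hand side exceed the global bound.
\<close>

lemma osc_translate_le:
  assumes lim: "(osc \<longlongrightarrow> 0) at_infinity" and \<epsilon>: "0 < \<epsilon>"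
  obtains R where "\<And>w x. R \<le> cmod w \<Longrightarrow> osc (w + x) \<le> \<epsilon> * (1 + cmod x)"
proof -
  obtain M where M: "0 < M" "\<And>z. osc z \<le> M" using osc_bounded[OF lim] by blast
  have "eventually (\<lambda>z. osc z < \<epsilon>) at_infinity"
    using lim \<epsilon> by (rule order_tendstoD)
  then obtain R where R: "\<And>z. R \<le> cmod z \<Longrightarrow> osc z < \<epsilon>"
    by (auto simp: eventually_at_infinity)
  have "osc (w + x) \<le> \<epsilon> * (1 + cmod x)" if w: "max (2 * R) (2 * M / \<epsilon>) \<le> cmod w" for w x
  proof (cases "cmod x \<le> cmod w / 2")
    case True
    have "cmod w \<le> cmod (w + x) + cmod x"
      using norm_triangle_ineq4[of "w + x" x] by simp
    then have "osc (w + x) < \<epsilon>" using True w by (intro R) auto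
    then show ?thesis using \<epsilon> by (simp add: distrib_left add_increasing2)
  next
    case False
    have "2 * M \<le> \<epsilon> * cmod w" using w \<epsilon> by (simp add: field_simps)
    also have "\<dots> \<le> \<epsilon> * (2 * cmod x)" using False \<epsilon> by (intro mult_left_mono) auto
    finally have "M \<le> \<epsilon> * cmod x" by simp
    then show ?thesis using M(2)[of "w + x"] \<epsilon> by (simp add: distrib_left)
  qed
  then show ?thesis by (rule that)
qed

text \<open>
  The value \<open>g(z)\<close> is compared with \<open>avg w\<close> through \<open>avg y\<close>, averaged over all \<open>y\<close> with \<open>|y - z| \<le> r\<close>.
  After exchanging the integrals, \<open>|g(z) - avg y|^p\<close> integrates to the oscillation at \<open>y\<close>, while
  \<open>|avg y - avg w|\<close> grows at most quadratically in \<open>|y - w|\<close>.  Integrating over \<open>y\<close> instead of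
  choosing \<open>y = z\<close> is what brings in the mean oscillation.
\<close>

lemma nn_integral_gaussian_avg_le:
  assumes c: "0 < c"
  obtains C where "0 < C"
    "\<And>w \<epsilon>. (\<And>x. osc (w + x) \<le> \<epsilon> * (1 + cmod x)) \<Longrightarrow>
      (\<integral>\<^sup>+z. ennreal (cmod (g z - avg w) powr p * exp (- c * (cmod (z - w))\<^sup>2)) \<partial>lebesgue) \<le> ennreal (C * \<epsilon> powr p)"
proof -
  obtain B where B: "0 < B" "\<And>w. (\<integral>\<^sup>+z. ennreal ((1 + cmod (z - w)) powr (2 * p) * exp (- (c / 2) * (cmod (z - w))\<^sup>2)) \<partial>lebesgue) \<le> ennreal B"
    using nn_integral_gaussian_moment[of "c / 2" "2 * p"] c by auto
  define A where "A = pi * r\<^sup>2"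
  define \<kappa> where "\<kappa> = 32 * (1 + 1 / r)"
  define D where "D = 2 powr p * exp (c * r\<^sup>2)"
  define C where "C = D * (1 + \<kappa> powr p) * B"
  have pos: "0 < A" "0 < \<kappa>" "0 < D" "0 < C"
    using r_pos B by (auto simp: A_def \<kappa>_def D_def C_def intro!: mult_pos_pos add_pos_nonneg)
  have "(\<integral>\<^sup>+z. ennreal (cmod (g z - avg w) powr p * exp (- c * (cmod (z - w))\<^sup>2)) \<partial>lebesgue) \<le> ennreal (C * \<epsilon> powr p)"
    if \<epsilon>: "\<And>x. osc (w + x) \<le> \<epsilon> * (1 + cmod x)" for w \<epsilon>
  proof -
    let ?\<phi> = "\<lambda>z. cmod (g z - avg w) powr p * exp (- c * (cmod (z - w))\<^sup>2)"
    let ?J = "\<lambda>y z. ennreal (D * exp (- (c / 2) * (cmod (y - w))\<^sup>2)) *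
        (ennreal (cmod (g z - avg y) powr p * indicator (cball y r) z)
          + ennreal (cmod (avg y - avg w) powr p) * indicator (cball y r) z)"
    have \<epsilon>0: "0 \<le> \<epsilon>" using \<epsilon>[of 0] osc_nonneg[of w] by simp
    have "(\<integral>\<^sup>+z. ennreal (?\<phi> z) \<partial>lebesgue) * ennreal A = (\<integral>\<^sup>+z. ennreal (?\<phi> z) * ennreal A \<partial>lebesgue)"
      by (rule nn_integral_multc[symmetric]) measurable
    also have "\<dots> = (\<integral>\<^sup>+z. \<integral>\<^sup>+y. ennreal (?\<phi> z) * indicator (cball z r) y \<partial>lebesgue \<partial>lebesgue)"
      using r_pos by (simp add: nn_integral_cmult_indicator emeasure_cball_complex A_def)
    also have "\<dots> \<le> (\<integral>\<^sup>+z. \<integral>\<^sup>+y. ?J y z \<partial>lebesgue \<partial>lebesgue)"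
    proof (intro nn_integral_mono)
      fix z y
      show "ennreal (?\<phi> z) * indicator (cball z r) y \<le> ?J y z"
      proof (cases "dist z y \<le> r")
        case True
        have "cmod (g z - avg w) \<le> cmod (g z - avg y) + cmod (avg y - avg w)"
          by norm
        then have "cmod (g z - avg w) powr p \<le> (cmod (g z - avg y) + cmod (avg y - avg w)) powr p"
          using p_ge_1 by (intro powr_mono2) auto
        also have "\<dots> \<le> 2 powr p * (cmod (g z - avg y) powr p + cmod (avg y - avg w) powr p)"
          using p_ge_1 by (intro powr_add_le) auto
        finally have 1: "cmod (g z - avg w) powr p \<le> 2 powr p * (cmod (g z - avg y) powr p + cmod (avg y - avg w) powr p)" .
        have 2: "exp (- c * (cmod (z - w))\<^sup>2) \<le> exp (c * r\<^sup>2) * exp (- (c / 2) * (cmod (y - w))\<^sup>2)"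
          using exp_gaussian_shift_le[of c z y r w] c True by (simp add: norm_minus_commute)
        have "?\<phi> z \<le> (2 powr p * (cmod (g z - avg y) powr p + cmod (avg y - avg w) powr p)) * (exp (c * r\<^sup>2) * exp (- (c / 2) * (cmod (y - w))\<^sup>2))"
          by (intro mult_mono 1 2) auto
        then show ?thesis
          using True pos by (simp add: dist_commute D_def ennreal_mult[symmetric] ennreal_plus[symmetric] ennreal_leI mult_ac del: ennreal_plus)
      qed simp
    qed
    also have "\<dots> = (\<integral>\<^sup>+y. \<integral>\<^sup>+z. ?J y z \<partial>lebesgue \<partial>lebesgue)"
      by (rule lebesgue_pair.Fubini') (unfold indicator_def mem_cball, measurable)
    also have "\<dots> = (\<integral>\<^sup>+y. ennreal (D * exp (- (c / 2) * (cmod (y - w))\<^sup>2)) *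
        (ennreal (A * osc y powr p) + ennreal (cmod (avg y - avg w) powr p) * ennreal A) \<partial>lebesgue)"
      using r_pos by (simp add: nn_integral_cmult nn_integral_add nn_integral_osc nn_integral_cmult_indicator emeasure_cball_complex A_def)
    also have "\<dots> \<le> (\<integral>\<^sup>+y. ennreal (A * (D * (1 + \<kappa> powr p)) * \<epsilon> powr p) *
        ennreal ((1 + cmod (y - w)) powr (2 * p) * exp (- (c / 2) * (cmod (y - w))\<^sup>2)) \<partial>lebesgue)"
    proof (intro nn_integral_mono)
      fix y
      let ?t = "1 + cmod (y - w)"
      have t: "?t powr (2 * p) = (?t\<^sup>2) powr p"
        by (simp add: powr_powr flip: powr_numeral)
      have "osc y \<le> \<epsilon> * ?t" using \<epsilon>[of "y - w"] by simp
      also have "\<dots> \<le> \<epsilon> * ?t\<^sup>2"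
        using \<epsilon>0 by (intro mult_left_mono self_le_power) auto
      finally have "osc y powr p \<le> (\<epsilon> * ?t\<^sup>2) powr p"
        using p_ge_1 osc_nonneg by (intro powr_mono2) auto
      then have 1: "osc y powr p \<le> \<epsilon> powr p * ?t powr (2 * p)"
        using \<epsilon>0 by (simp add: powr_mult t)
      have "cmod (avg y - avg w) \<le> \<kappa> * \<epsilon> * ?t\<^sup>2"
        using avg_growth[of w \<epsilon> "y - w"] \<epsilon> by (simp add: \<kappa>_def)
      then have "cmod (avg y - avg w) powr p \<le> (\<kappa> * \<epsilon> * ?t\<^sup>2) powr p"
        using p_ge_1 by (intro powr_mono2) auto
      then have 2: "cmod (avg y - avg w) powr p \<le> \<kappa> powr p * (\<epsilon> powr p * ?t powr (2 * p))"
        using \<epsilon>0 pos by (simp add: powr_mult t mult.assoc)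
      have "A * osc y powr p + cmod (avg y - avg w) powr p * A \<le> A * ((1 + \<kappa> powr p) * (\<epsilon> powr p * ?t powr (2 * p)))"
        using mult_left_mono[OF add_mono[OF 1 2], of A] pos by (simp add: algebra_simps)
      then have "D * exp (- (c / 2) * (cmod (y - w))\<^sup>2) * (A * osc y powr p + cmod (avg y - avg w) powr p * A)
         \<le> D * exp (- (c / 2) * (cmod (y - w))\<^sup>2) * (A * ((1 + \<kappa> powr p) * (\<epsilon> powr p * ?t powr (2 * p))))"
        using pos by (intro mult_left_mono) auto
      also have "\<dots> = (A * (D * (1 + \<kappa> powr p)) * \<epsilon> powr p) * (?t powr (2 * p) * exp (- (c / 2) * (cmod (y - w))\<^sup>2))"
        by (simp add: mult_ac)
      finally show "ennreal (D * exp (- (c / 2) * (cmod (y - w))\<^sup>2)) *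
        (ennreal (A * osc y powr p) + ennreal (cmod (avg y - avg w) powr p) * ennreal A) \<le>
        ennreal (A * (D * (1 + \<kappa> powr p)) * \<epsilon> powr p) * ennreal (?t powr (2 * p) * exp (- (c / 2) * (cmod (y - w))\<^sup>2))"
        using pos by (simp add: ennreal_mult[symmetric] ennreal_plus[symmetric] ennreal_leI del: ennreal_plus)
    qed
    also have "\<dots> = ennreal (A * (D * (1 + \<kappa> powr p)) * \<epsilon> powr p) *
        (\<integral>\<^sup>+y. ennreal ((1 + cmod (y - w)) powr (2 * p) * exp (- (c / 2) * (cmod (y - w))\<^sup>2)) \<partial>lebesgue)"
      by (rule nn_integral_cmult) measurable
    also have "\<dots> \<le> ennreal (A * (D * (1 + \<kappa> powr p)) * \<epsilon> powr p) * ennreal B"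
      by (intro mult_left_mono B) auto
    also have "\<dots> = ennreal (C * \<epsilon> powr p) * ennreal A"
      using pos B by (simp add: C_def ennreal_mult[symmetric] mult_ac)
    finally show ?thesis
      using pos by (subst (asm) ennreal_mult_le_mult_iff[of "ennreal A", unfolded mult.commute[of "ennreal A"]]) auto
  qed
  then show ?thesis using that pos by blast
qed

text \<open>
  The function \<open>\<Psi>\<close> of the introduction, with \<open>c\<close> in place of \<open>1/8\<close>: the density against which
  \<open>|f|^p\<close> is integrated in the bound for the Hankel operator.  It takes values in \<open>ennreal\<close> because it is
  finite only for symbols whose oscillation is controlled globally.
\<close>

definition local_oscillation :: "real \<Rightarrow> complex \<Rightarrow> ennreal" where
  "local_oscillation c w = (\<integral>\<^sup>+v. (\<integral>\<^sup>+z. ennreal (cmod (g z - g v) powr p * exp (- c * (cmod (z - v))\<^sup>2)) \<partial>lebesgue)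
     * indicator (cball w r) v \<partial>lebesgue)"

text \<open>
  Compare both \<open>g(z)\<close> and \<open>g(v)\<close> with \<open>avg w\<close>.  As \<open>v\<close> stays within distance \<open>r\<close> of \<open>w\<close>, the Gaussian
  centred at \<open>v\<close> may be replaced by a wider one centred at \<open>w\<close>.
\<close>

lemma local_oscillation_le:
  assumes c: "0 < c"
  obtains C where "0 < C"
    "\<And>w \<epsilon>. (\<And>x. osc (w + x) \<le> \<epsilon> * (1 + cmod x)) \<Longrightarrow> local_oscillation c w \<le> ennreal (C * \<epsilon> powr p)"
proof -
  obtain C1 where C1: "0 < C1"
    "\<And>w \<epsilon>. (\<And>x. osc (w + x) \<le> \<epsilon> * (1 + cmod x)) \<Longrightarrow>
      (\<integral>\<^sup>+z. ennreal (cmod (g z - avg w) powr p * exp (- (c / 2) * (cmod (z - w))\<^sup>2)) \<partial>lebesgue) \<le> ennreal (C1 * \<epsilon> powr p)"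
    using nn_integral_gaussian_avg_le[of "c / 2"] c by auto
  obtain B where B: "0 < B" "\<And>w. (\<integral>\<^sup>+z. ennreal ((1 + cmod (z - w)) powr 0 * exp (- c * (cmod (z - w))\<^sup>2)) \<partial>lebesgue) \<le> ennreal B"
    using nn_integral_gaussian_moment[OF c, of 0] by blast
  have B': "(\<integral>\<^sup>+z. ennreal (exp (- c * (cmod (z - w))\<^sup>2)) \<partial>lebesgue) \<le> ennreal B" for w
  proof -
    have "1 + cmod (z - w) \<noteq> 0" for z using norm_ge_zero[of "z - w"] by linarith
    then show ?thesis using B(2)[of w] by simp
  qed
  define A where "A = pi * r\<^sup>2"
  define D where "D = exp (c * r\<^sup>2) * C1"
  define C where "C = 2 powr p * A * (D + B)"
  have pos: "0 < A" "0 < D" "0 < C"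
    using r_pos B C1 by (auto simp: A_def D_def C_def intro!: mult_pos_pos add_pos_pos)
  have "local_oscillation c w \<le> ennreal (C * \<epsilon> powr p)" if \<epsilon>: "\<And>x. osc (w + x) \<le> \<epsilon> * (1 + cmod x)" for w \<epsilon>
  proof -
    let ?E = "\<lambda>z v. exp (- c * (cmod (z - v))\<^sup>2)"
    let ?h = "\<lambda>v. cmod (g v - avg w) powr p"
    let ?I = "\<lambda>v. indicator (cball w r) v :: ennreal"
    have inner: "(\<integral>\<^sup>+z. ennreal (cmod (g z - g v) powr p * ?E z v) \<partial>lebesgue) * ?I v
      \<le> ennreal (2 powr p) * (ennreal (D * \<epsilon> powr p) * ?I v + ennreal (?h v * indicator (cball w r) v) * ennreal B)" for v
    proof (cases "v \<in> cball w r")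
      case True
      have "(\<integral>\<^sup>+z. ennreal (cmod (g z - g v) powr p * ?E z v) \<partial>lebesgue) \<le>
         (\<integral>\<^sup>+z. ennreal (2 powr p) * (ennreal (exp (c * r\<^sup>2)) * ennreal (?h z * exp (- (c / 2) * (cmod (z - w))\<^sup>2))
            + ennreal (?h v) * ennreal (?E z v)) \<partial>lebesgue)"
      proof (intro nn_integral_mono)
        fix z
        have "cmod (g z - g v) \<le> cmod (g z - avg w) + cmod (g v - avg w)" by norm
        then have "cmod (g z - g v) powr p \<le> (cmod (g z - avg w) + cmod (g v - avg w)) powr p"
          using p_ge_1 by (intro powr_mono2) auto
        also have "\<dots> \<le> 2 powr p * (?h z + ?h v)"
          using p_ge_1 by (intro powr_add_le) auto
        finally have "cmod (g z - g v) powr p * ?E z v \<le> 2 powr p * (?h z + ?h v) * ?E z v"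
          by (rule mult_right_mono) simp
        also have "\<dots> = 2 powr p * (?h z * ?E z v + ?h v * ?E z v)" by (simp add: algebra_simps)
        also have "\<dots> \<le> 2 powr p * (?h z * (exp (c * r\<^sup>2) * exp (- (c / 2) * (cmod (z - w))\<^sup>2)) + ?h v * ?E z v)"
          using True c by (intro mult_left_mono add_right_mono exp_gaussian_shift_le) (auto simp: dist_commute)
        finally show "ennreal (cmod (g z - g v) powr p * ?E z v) \<le>
          ennreal (2 powr p) * (ennreal (exp (c * r\<^sup>2)) * ennreal (?h z * exp (- (c / 2) * (cmod (z - w))\<^sup>2))
            + ennreal (?h v) * ennreal (?E z v))"
          by (simp add: ennreal_mult[symmetric] ennreal_plus[symmetric] ennreal_leI mult_ac del: ennreal_plus)
      qed
      also have "\<dots> = ennreal (2 powr p) * (ennreal (exp (c * r\<^sup>2)) * (\<integral>\<^sup>+z. ennreal (?h z * exp (- (c / 2) * (cmod (z - w))\<^sup>2)) \<partial>lebesgue)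
            + ennreal (?h v) * (\<integral>\<^sup>+z. ennreal (?E z v) \<partial>lebesgue))"
        by (simp add: nn_integral_cmult nn_integral_add)
      also have "\<dots> \<le> ennreal (2 powr p) * (ennreal (exp (c * r\<^sup>2)) * ennreal (C1 * \<epsilon> powr p) + ennreal (?h v) * ennreal B)"
        by (intro mult_left_mono add_mono C1 B' \<epsilon>) auto
      finally show ?thesis using True C1 by (simp add: D_def ennreal_mult[symmetric] mult_ac)
    qed simp
    have "local_oscillation c w \<le> (\<integral>\<^sup>+v. ennreal (2 powr p) * (ennreal (D * \<epsilon> powr p) * ?I v + ennreal (?h v * indicator (cball w r) v) * ennreal B) \<partial>lebesgue)"
      unfolding local_oscillation_def by (intro nn_integral_mono inner)
    also have "\<dots> = ennreal (2 powr p) * (ennreal (D * \<epsilon> powr p) * ennreal A + ennreal (A * osc w powr p) * ennreal B)"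
      using r_pos by (simp add: nn_integral_cmult nn_integral_add nn_integral_multc nn_integral_osc nn_integral_cmult_indicator emeasure_cball_complex A_def)
    also have "\<dots> \<le> ennreal (2 powr p) * (ennreal (D * \<epsilon> powr p) * ennreal A + ennreal (A * \<epsilon> powr p) * ennreal B)"
      using \<epsilon>[of 0] osc_nonneg[of w] pos p_ge_1
      by (intro mult_left_mono add_left_mono mult_right_mono ennreal_leI powr_mono2) auto
    also have "\<dots> = ennreal (C * \<epsilon> powr p)"
      using pos B by (simp add: C_def ennreal_mult[symmetric] ennreal_plus[symmetric] algebra_simps del: ennreal_plus)
    finally show ?thesis .
  qed
  then show ?thesis using that pos by blast
qed

end

section \<open>Kernel decay and the local size of entire functions\<close>

lemma kernel_eq:
  "(cnj z * v) ^ m * kernel m z v = fact m * (exp (cnj z * v) - (\<Sum>j<m. (cnj z * v) ^ j / fact j))"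
proof -
  define x where "x = cnj z * v"
  have sm: "summable (\<lambda>n. x ^ n / fact n)"
    using summable_exp[of x] by (simp add: divide_inverse mult.commute)
  have ex: "exp x = (\<Sum>n. x ^ n / fact n)"
    by (simp add: exp_def scaleR_conv_of_real divide_inverse mult.commute)
  have "exp x - (\<Sum>j<m. x ^ j / fact j) = (\<Sum>n. x ^ (n + m) / fact (n + m))"
    unfolding ex using suminf_split_initial_segment[OF sm, of m] by simp
  also have "fact m * \<dots> = (\<Sum>n. fact m * (x ^ (n + m) / fact (n + m)))"
    using sm by (intro suminf_mult[symmetric]) (subst summable_iff_shift)
  also have "\<dots> = (\<Sum>n. x ^ m * (of_real (fact m / fact (n + m)) * x ^ n))"
    by (intro suminf_cong) (simp add: power_add)
  also have "\<dots> = x ^ m * kernel m z v"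
  proof (cases "x = 0 \<and> m \<noteq> 0")
    case True
    then have "x ^ m = 0" by simp
    then show ?thesis by (simp only: mult_zero_left suminf_zero)
  next
    case False
    have "summable (\<lambda>n. x ^ m * (of_real (fact m / fact (n + m)) * x ^ n))"
      using summable_mult[OF iffD2[OF summable_iff_shift[of _ m] sm], of "fact m"]
      by (simp add: power_add mult_ac)
    then have "summable (\<lambda>n. of_real (fact m / fact (n + m)) * x ^ n)"
      using False by (subst (asm) summable_cmult_iff) auto
    then show ?thesis unfolding kernel_def x_def[symmetric] by (rule suminf_mult)
  qed
  finally show ?thesis unfolding x_def ..
qed

text \<open>
  The factors \<open>|z|^m |v|^m\<close> turn the kernel into \<open>m! (exp x - Taylor polynomial)\<close> with \<open>x = cnj z * v\<close>.
  The exponential contributes exactly \<open>exp(-|z-v|^2/2)\<close>; the polynomial is absorbed by half of the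
  weight, and \<open>|z-v|^2 \<le> 2(|z|^2+|v|^2)\<close> turns the remaining half into Gaussian decay.
\<close>

lemma kernel_weighted_le:
  "cmod z ^ m * cmod v ^ m * cmod (kernel m z v) * exp (- ((cmod z)\<^sup>2 + (cmod v)\<^sup>2) / 2)
     \<le> fact m * (1 + 2 ^ m) * exp (- (1 / 8) * (cmod (z - v))\<^sup>2)"
proof -
  define x where "x = cnj z * v"
  define s where "s = ((cmod z)\<^sup>2 + (cmod v)\<^sup>2) / 4"
  define t where "t = (cmod (z - v))\<^sup>2"
  have s0: "0 \<le> s" by (simp add: s_def)
  have t: "t \<le> 8 * s"
  proof -
    have "t \<le> (cmod z + cmod v)\<^sup>2"
      unfolding t_def by (intro power_mono norm_triangle_ineq4) auto
    also have "\<dots> \<le> 8 * s"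
      using sum_squares_bound[of "cmod z" "cmod v"] by (simp add: s_def power2_sum)
    finally show ?thesis .
  qed
  have Re_x: "Re x = 2 * s - t / 2"
    unfolding x_def s_def t_def cmod_power2 by (simp add: power2_eq_square field_simps)
  have norm_x: "cmod x \<le> 2 * s"
    using sum_squares_bound[of "cmod z" "cmod v"] by (simp add: x_def s_def norm_mult)
  have "cmod (\<Sum>j<m. x ^ j / fact j) \<le> (\<Sum>j<m. cmod x ^ j / fact j)"
    by (rule order_trans[OF norm_sum]) (simp add: norm_divide norm_power)
  also have "\<dots> \<le> (\<Sum>j<m. 2 ^ m * (s ^ j / fact j))"
  proof (rule sum_mono)
    fix j assume "j \<in> {..<m}"
    have "cmod x ^ j \<le> (2 * s) ^ j" using norm_x by (intro power_mono) auto
    also have "\<dots> \<le> 2 ^ m * s ^ j"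
      unfolding power_mult_distrib using \<open>j \<in> {..<m}\<close> s0 by (intro mult_right_mono power_increasing) auto
    finally show "cmod x ^ j / fact j \<le> 2 ^ m * (s ^ j / fact j)"
      by (simp add: divide_right_mono)
  qed
  also have "\<dots> = 2 ^ m * (\<Sum>j<m. s ^ j / fact j)"
    by (simp add: sum_distrib_left)
  also have "(\<Sum>j<m. s ^ j / fact j) \<le> exp s"
    unfolding exp_def using s0 summable_exp[of s]
    by (simp add: divide_inverse mult.commute) (intro sum_le_suminf, auto simp: mult.commute)
  finally have tail: "cmod (\<Sum>j<m. x ^ j / fact j) \<le> 2 ^ m * exp s" by simp
  have keq: "x ^ m * kernel m z v = fact m * (exp x - (\<Sum>j<m. x ^ j / fact j))"
    unfolding x_def by (rule kernel_eq)
  have "cmod z ^ m * cmod v ^ m * cmod (kernel m z v) = cmod (x ^ m * kernel m z v)"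
    by (simp add: x_def norm_mult norm_power power_mult_distrib)
  also have "\<dots> \<le> fact m * (exp (Re x) + 2 ^ m * exp s)"
    unfolding keq norm_mult
    using order_trans[OF norm_triangle_ineq4[of "exp x" "\<Sum>j<m. x ^ j / fact j"] add_left_mono[OF tail]]
    by (simp add: mult_left_mono)
  finally have "cmod z ^ m * cmod v ^ m * cmod (kernel m z v) * exp (- 2 * s) \<le> fact m * (exp (Re x) + 2 ^ m * exp s) * exp (- 2 * s)"
    by (rule mult_right_mono) simp
  also have "\<dots> = fact m * (exp (- (t / 2)) + 2 ^ m * exp (- s))"
    by (simp add: Re_x algebra_simps flip: exp_add)
  also have "\<dots> \<le> fact m * (exp (- (1 / 8) * t) + 2 ^ m * exp (- (1 / 8) * t))"
    using t by (intro mult_left_mono add_mono) (auto simp: t_def)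
  also have "\<dots> = fact m * (1 + 2 ^ m) * exp (- (1 / 8) * t)"
    by (simp add: algebra_simps)
  also have "- 2 * s = - ((cmod z)\<^sup>2 + (cmod v)\<^sup>2) / 2"
    by (simp add: s_def)
  finally show ?thesis unfolding t_def .
qed

text \<open>
  A sub-mean-value inequality with a non-optimal constant, without polar coordinates.  Let \<open>w0\<close>
  maximise \<open>|G(w)|^p (r - |w-v|)^2\<close> over the disc and let \<open>2d\<close> be the distance of \<open>w0\<close> from the boundary.
  By maximality \<open>|G| \<le> 4 |G(w0)|\<close> within distance \<open>d\<close> of \<open>w0\<close>, so Cauchy's estimate bounds \<open>G'\<close> by
  \<open>8 |G(w0)| / d\<close> near \<open>w0\<close>, and therefore \<open>|G| \<ge> |G(w0)|/2\<close> within distance \<open>d/16\<close>.  That small disc alone carries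
  enough of the integral, since its area is comparable to \<open>d^2\<close> and \<open>|G(v)|^p r^2 \<le> |G(w0)|^p (2d)^2\<close>.
\<close>

lemma holomorphic_powr_le_integral:
  assumes hol: "G holomorphic_on UNIV" and r: "0 < r" and p: "1 \<le> p"
  shows "ennreal (cmod (G v) powr p * r\<^sup>2) \<le>
     ennreal (2 powr p * 1024 / pi) * (\<integral>\<^sup>+w. ennreal (cmod (G w) powr p * indicator (cball v r) w) \<partial>lebesgue)"
proof (cases "G v = 0")
  case False
  define \<phi> where "\<phi> = (\<lambda>w. cmod (G w) powr p * (r - dist v w)\<^sup>2)"
  have cont: "continuous_on S G" for S
    using holomorphic_on_imp_continuous_on[OF hol] continuous_on_subset by blast
  have "continuous_on (cball v r) \<phi>"
    unfolding \<phi>_def using p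
    by (intro continuous_intros continuous_on_powr' cont) auto
  then obtain w0 where w0: "w0 \<in> cball v r" "\<And>w. w \<in> cball v r \<Longrightarrow> \<phi> w \<le> \<phi> w0"
    using continuous_attains_sup[of "cball v r" \<phi>] r by auto
  define d where "d = (r - dist v w0) / 2"
  define a where "a = cmod (G w0)"
  have \<phi>w0: "\<phi> w0 = a powr p * (2 * d)\<^sup>2"
  proof -
    have "2 * d = r - dist v w0" by (simp add: d_def)
    then show ?thesis by (simp only: \<phi>_def a_def)
  qed
  have "0 < cmod (G v) powr p * r\<^sup>2" using False r by simp
  also have \<phi>v: "cmod (G v) powr p * r\<^sup>2 \<le> a powr p * (2 * d)\<^sup>2"
    using w0(2)[of v] r unfolding \<phi>w0 by (simp add: \<phi>_def)
  finally have "a \<noteq> 0" "d \<noteq> 0" by auto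
  then have pos: "0 < a" "0 < d" using w0 by (auto simp: a_def d_def)
  have bound: "cmod (G w) \<le> 4 * a" if "dist w0 w \<le> d" for w
  proof -
    have dv: "dist v w \<le> r - d"
    proof -
      have "r - d = dist v w0 + d" by (simp add: d_def field_simps)
      then show ?thesis using that dist_triangle[of v w w0] by simp
    qed
    then have "\<phi> w \<le> \<phi> w0" using pos by (intro w0) auto
    moreover have "cmod (G w) powr p * d\<^sup>2 \<le> \<phi> w"
      unfolding \<phi>_def using dv pos by (intro mult_left_mono power_mono) auto
    ultimately have "cmod (G w) powr p * d\<^sup>2 \<le> (4 * a powr p) * d\<^sup>2"
      unfolding \<phi>w0 by (simp add: power_mult_distrib mult_ac)
    then have "cmod (G w) powr p \<le> 4 * a powr p" using pos by simp
    also have "\<dots> \<le> 4 powr p * a powr p"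
      using powr_mono[of 1 p "4::real"] p by (intro mult_right_mono) auto
    also have "\<dots> = (4 * a) powr p" using pos by (simp add: powr_mult)
    finally show ?thesis using p powr_less_mono2[of p "4 * a" "cmod (G w)"] pos by fastforce
  qed
  have deriv_le: "cmod (deriv G \<xi>) \<le> 8 * a / d" if \<xi>: "\<xi> \<in> cball w0 (d / 16)" for \<xi>
  proof -
    have "cmod ((deriv ^^ 1) G \<xi>) \<le> fact 1 * (4 * a) / (d / 2) ^ 1"
    proof (rule Cauchy_inequality)
      show "G holomorphic_on ball \<xi> (d / 2)" using hol holomorphic_on_subset by blast
      fix x assume "cmod (\<xi> - x) = d / 2"
      then have "dist w0 x \<le> d"
        using \<xi> dist_triangle[of w0 x \<xi>] pos by (simp add: dist_norm)
      then show "cmod (G x) \<le> 4 * a" by (rule bound)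
    qed (use pos cont in auto)
    then show ?thesis by simp
  qed
  have lower: "a / 2 \<le> cmod (G w)" if w: "w \<in> cball w0 (d / 16)" for w
  proof -
    have "cmod (G w - G w0) \<le> 8 * a / d * cmod (w - w0)"
    proof (rule field_differentiable_bound[of "cball w0 (d / 16)" G "deriv G"])
      fix z show "(G has_field_derivative deriv G z) (at z within cball w0 (d / 16))"
        using hol by (simp add: holomorphic_derivI has_field_derivative_at_within)
    qed (use deriv_le w pos in auto)
    also have "\<dots> \<le> 8 * a / d * (d / 16)"
      using w pos by (intro mult_left_mono) (auto simp: dist_norm norm_minus_commute)
    also have "\<dots> = a / 2" using pos by simp
    finally have "cmod (G w - G w0) \<le> a / 2" .
    moreover have "a \<le> cmod (G w) + cmod (G w - G w0)"
      unfolding a_def by norm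
    ultimately show ?thesis by linarith
  qed
  have sub: "cball w0 (d / 16) \<subseteq> cball v r"
    using pos by (subst cball_subset_cball_iff) (auto simp: d_def dist_commute field_simps)
  have "ennreal ((a / 2) powr p * (pi * (d / 16)\<^sup>2)) = (\<integral>\<^sup>+w. ennreal ((a / 2) powr p) * indicator (cball w0 (d / 16)) w \<partial>lebesgue)"
    using pos by (simp add: nn_integral_cmult_indicator emeasure_cball_complex ennreal_mult del: power_divide)
  also have "\<dots> \<le> (\<integral>\<^sup>+w. ennreal (cmod (G w) powr p * indicator (cball v r) w) \<partial>lebesgue)"
  proof (intro nn_integral_mono)
    fix w
    show "ennreal ((a / 2) powr p) * indicator (cball w0 (d / 16)) w \<le> ennreal (cmod (G w) powr p * indicator (cball v r) w)"
    proof (cases "w \<in> cball w0 (d / 16)")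
      case True
      have "(a / 2) powr p \<le> cmod (G w) powr p"
        using lower[OF True] pos p by (intro powr_mono2) auto
      then show ?thesis using True sub by (auto simp: ennreal_leI)
    qed simp
  qed
  finally have low: "ennreal ((a / 2) powr p * (pi * (d / 16)\<^sup>2)) \<le> (\<integral>\<^sup>+w. ennreal (cmod (G w) powr p * indicator (cball v r) w) \<partial>lebesgue)" .
  have "cmod (G v) powr p * r\<^sup>2 \<le> (2 powr p * 1024 / pi) * ((a / 2) powr p * (pi * (d / 16)\<^sup>2))"
    using \<phi>v pos by (simp add: powr_divide power_divide power_mult_distrib)
  then have "ennreal (cmod (G v) powr p * r\<^sup>2) \<le> ennreal (2 powr p * 1024 / pi) * ennreal ((a / 2) powr p * (pi * (d / 16)\<^sup>2))"
    using pos by (simp add: ennreal_mult[symmetric] ennreal_leI)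
  also have "\<dots> \<le> ennreal (2 powr p * 1024 / pi) * (\<integral>\<^sup>+w. ennreal (cmod (G w) powr p * indicator (cball v r) w) \<partial>lebesgue)"
    using low by (rule mult_left_mono) simp
  finally show ?thesis .
qed simp

text \<open>
  The weighted modulus \<open>U\<close> of the introduction.  It does not involve \<open>p\<close>: its \<open>p\<close>-th power is the integrand
  of the \<open>L^{p,m}\<close> norm for every \<open>p\<close>.
\<close>

definition fock_modulus :: "nat \<Rightarrow> (complex \<Rightarrow> complex) \<Rightarrow> complex \<Rightarrow> real" where
  "fock_modulus m f v = cmod (f v) * cmod v ^ m * exp (- (cmod v)\<^sup>2 / 2)"

lemma fock_modulus_nonneg: "0 \<le> fock_modulus m f v"
  by (simp add: fock_modulus_def)

lemma fock_modulus_powr: "fock_modulus m f v powr p = cmod (f v) powr p * Lweight p m v"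
  by (simp add: fock_modulus_def Lweight_def powr_mult exp_powr_real)

lemma measurable_fock_modulus [measurable]:
  assumes [measurable]: "f \<in> borel_measurable lebesgue"
  shows "fock_modulus m f \<in> borel_measurable lebesgue"
  unfolding fock_modulus_def[abs_def] by measurable

text \<open>
  The weight \<open>exp(-|w|^2/2)\<close> is not the modulus of a holomorphic function, but on the disc about \<open>v\<close> it is
  one up to a constant and a bounded factor: \<open>|w|^2/2 = Re (w * cnj v) - |v|^2/2 + |w-v|^2/2\<close>.  So the sub-mean-value inequality
  applies to \<open>f(w) w^m exp(-w * cnj v)\<close>.
\<close>

lemma fock_modulus_powr_le_integral:
  assumes r: "0 < r" and p: "1 \<le> p"
  obtains C where "0 < C"
    "\<And>f v. f holomorphic_on UNIV \<Longrightarrow> ennreal (fock_modulus m f v powr p) \<le>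
      ennreal C * (\<integral>\<^sup>+w. ennreal (fock_modulus m f w powr p) * indicator (cball v r) w \<partial>lebesgue)"
proof -
  define K where "K = 2 powr p * 1024 / pi"
  define E where "E = exp (p * r\<^sup>2 / 2)"
  have "ennreal (fock_modulus m f v powr p) \<le>
      ennreal (K * E / r\<^sup>2) * (\<integral>\<^sup>+w. ennreal (fock_modulus m f w powr p) * indicator (cball v r) w \<partial>lebesgue)"
    if hol: "f holomorphic_on UNIV" for f v
  proof -
    define G where "G = (\<lambda>w. f w * w ^ m * exp (- (w * cnj v)))"
    define b where "b = exp ((cmod v)\<^sup>2 / 2)"
    have holG: "G holomorphic_on UNIV"
      unfolding G_def by (intro holomorphic_intros hol)
    have [measurable]: "f \<in> borel_measurable lebesgue"
      using holomorphic_on_imp_continuous_on[OF hol]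
      by (intro measurable_completion) (auto intro: borel_measurable_continuous_onI)
    have U: "cmod (G w) * b = fock_modulus m f w * exp ((cmod (w - v))\<^sup>2 / 2)" for w
    proof -
      have "- Re (w * cnj v) + (cmod v)\<^sup>2 / 2 = - (cmod w)\<^sup>2 / 2 + (cmod (w - v))\<^sup>2 / 2"
        unfolding cmod_power2 by (simp add: power2_eq_square field_simps)
      then have "exp (- Re (w * cnj v)) * b = exp (- (cmod w)\<^sup>2 / 2) * exp ((cmod (w - v))\<^sup>2 / 2)"
        unfolding b_def by (simp only: flip: exp_add)
      then show ?thesis by (simp add: G_def fock_modulus_def norm_mult norm_power)
    qed
    have "ennreal (fock_modulus m f v powr p * r\<^sup>2) = ennreal (cmod (G v) powr p * r\<^sup>2) * ennreal (b powr p)"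
      using U[of v] by (simp add: ennreal_mult[symmetric] powr_mult[symmetric] mult_ac b_def)
    also have "\<dots> \<le> (ennreal K * (\<integral>\<^sup>+w. ennreal (cmod (G w) powr p * indicator (cball v r) w) \<partial>lebesgue)) * ennreal (b powr p)"
      unfolding K_def by (intro mult_right_mono holomorphic_powr_le_integral holG r p) auto
    also have "\<dots> = ennreal K * (\<integral>\<^sup>+w. ennreal (cmod (G w) powr p * indicator (cball v r) w) * ennreal (b powr p) \<partial>lebesgue)"
      unfolding G_def by (subst nn_integral_multc) (auto simp: mult.assoc)
    also have "\<dots> \<le> ennreal K * (\<integral>\<^sup>+w. ennreal E * (ennreal (fock_modulus m f w powr p) * indicator (cball v r) w) \<partial>lebesgue)"
    proof (intro mult_left_mono nn_integral_mono)
      fix w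
      show "ennreal (cmod (G w) powr p * indicator (cball v r) w) * ennreal (b powr p) \<le>
          ennreal E * (ennreal (fock_modulus m f w powr p) * indicator (cball v r) w)"
      proof (cases "w \<in> cball v r")
        case True
        have "cmod (G w) powr p * b powr p = (fock_modulus m f w * exp ((cmod (w - v))\<^sup>2 / 2)) powr p"
          unfolding U[symmetric] by (simp add: powr_mult b_def)
        also have "\<dots> = fock_modulus m f w powr p * exp (p * (cmod (w - v))\<^sup>2 / 2)"
          by (simp add: powr_mult fock_modulus_nonneg exp_powr_real mult.commute)
        also have "\<dots> \<le> fock_modulus m f w powr p * E"
          unfolding E_def using True p r
          by (intro mult_left_mono) (auto simp: dist_norm norm_minus_commute intro!: mult_left_mono power_mono)
        finally show ?thesis using True
          by (simp add: ennreal_mult[symmetric] ennreal_leI mult_ac E_def)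
      qed simp
    qed simp
    also have "\<dots> = ennreal (K * E) * (\<integral>\<^sup>+w. ennreal (fock_modulus m f w powr p) * indicator (cball v r) w \<partial>lebesgue)"
      using ennreal_mult[of K E]
      by (subst nn_integral_cmult) (auto simp: mult.assoc K_def E_def)
    finally have "ennreal (1 / r\<^sup>2) * ennreal (fock_modulus m f v powr p * r\<^sup>2) \<le>
       ennreal (1 / r\<^sup>2) * (ennreal (K * E) * (\<integral>\<^sup>+w. ennreal (fock_modulus m f w powr p) * indicator (cball v r) w \<partial>lebesgue))"
      by (rule mult_left_mono) simp
    moreover have "ennreal (1 / r\<^sup>2) * ennreal (fock_modulus m f v powr p * r\<^sup>2) = ennreal (fock_modulus m f v powr p)"
      using r by (simp add: ennreal_mult[symmetric])
    moreover have "ennreal (1 / r\<^sup>2) * ennreal (K * E) = ennreal (K * E / r\<^sup>2)"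
      by (subst ennreal_mult[symmetric]) (auto simp: K_def E_def)
    ultimately show ?thesis by (simp only: mult.assoc[symmetric])
  qed
  moreover have "0 < K * E / r\<^sup>2" using r by (simp add: K_def E_def)
  ultimately show ?thesis by (intro that) auto
qed

section \<open>The norm bound for the Hankel operator\<close>

lemma measurable_kernel [measurable]:
  assumes [measurable]: "h \<in> borel_measurable M" "k \<in> borel_measurable M"
  shows "(\<lambda>x. kernel m (h x) (k x)) \<in> borel_measurable M"
  unfolding kernel_def by measurable

lemma measurable_hankel_integrand [measurable]:
  assumes [measurable]: "g \<in> borel_measurable lebesgue" "f \<in> borel_measurable lebesgue"
  shows "hankel_integrand m g f z \<in> borel_measurable lebesgue"
  unfolding hankel_integrand_def[abs_def] by measurable

lemma measurable_hankel [measurable]: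
  assumes [measurable]: "g \<in> borel_measurable lebesgue" "f \<in> borel_measurable lebesgue"
  shows "hankel m g f \<in> borel_measurable lebesgue"
proof -
  have "(\<lambda>z. LINT v|lebesgue. hankel_integrand m g f z v) \<in> borel_measurable lebesgue"
    unfolding hankel_integrand_def
    by (rule sigma_finite_measure.borel_measurable_lebesgue_integral[OF sigma_finite_lebesgue]) measurable
  then show ?thesis unfolding hankel_def[abs_def] by measurable
qed

lemma measurable_Lweight [measurable]: "Lweight p m \<in> borel_measurable lebesgue"
  unfolding Lweight_def[abs_def] by measurable

lemma measurable_entire:
  fixes f :: "complex \<Rightarrow> complex"
  assumes "f holomorphic_on UNIV"
  shows "f \<in> borel_measurable lebesgue"
  using holomorphic_on_imp_continuous_on[OF assms]
  by (intro measurable_completion) (auto intro: borel_measurable_continuous_onI)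

text \<open>
  Kernel decay and Jensen's inequality for the Gaussian measure.  Only a finite bound \<open>J\<close> for the
  \<open>p\<close>-th power integral enters, and it yields absolute convergence and the size estimate together.  The
  point \<open>z = 0\<close> is excluded because for \<open>m > 0\<close> the weight vanishes there.
\<close>

lemma hankel_pointwise_bound:
  assumes p: "1 \<le> p"
  obtains Q where "0 < Q"
    "\<And>g f z J. g \<in> borel_measurable lebesgue \<Longrightarrow> f \<in> borel_measurable lebesgue \<Longrightarrow> z \<noteq> 0 \<Longrightarrow> 0 \<le> J \<Longrightarrow>
      (\<integral>\<^sup>+v. ennreal ((cmod (g z - g v) * fock_modulus m f v) powr p * exp (- (1 / 8) * (cmod (z - v))\<^sup>2)) \<partial>lebesgue) \<le> ennreal J \<Longrightarrow>
      integrable lebesgue (hankel_integrand m g f z) \<and>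
      cmod (hankel m g f z) powr p * Lweight p m z \<le> Q * J"
proof -
  obtain W where W: "0 < W" "\<And>w. (\<integral>\<^sup>+z. ennreal ((1 + cmod (z - w)) powr 0 * exp (- (1 / 8) * (cmod (z - w))\<^sup>2)) \<partial>lebesgue) \<le> ennreal W"
    using nn_integral_gaussian_moment[of "1 / 8" 0] by auto
  have W': "(\<integral>\<^sup>+v. ennreal (exp (- (1 / 8) * (cmod (z - v))\<^sup>2)) \<partial>lebesgue) \<le> ennreal W" for z
  proof -
    have "1 + cmod (v - z) \<noteq> 0" for v using norm_ge_zero[of "v - z"] by linarith
    then show ?thesis using W(2)[of z] by (simp add: norm_minus_commute)
  qed
  define D where "D = fact m * (1 + 2 ^ m :: real)"
  define R where "R = 1 / (pi * fact m) * (D * (2 * W powr (1 - 1 / p)))"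
  have D: "0 < D" by (simp add: D_def add_pos_pos)
  have R: "0 < R" using W D by (simp add: R_def)
  have "integrable lebesgue (hankel_integrand m g f z) \<and> cmod (hankel m g f z) powr p * Lweight p m z \<le> R powr p * J"
    if [measurable]: "g \<in> borel_measurable lebesgue" "f \<in> borel_measurable lebesgue"
      and z: "z \<noteq> 0" and J: "0 \<le> J"
      and int: "(\<integral>\<^sup>+v. ennreal ((cmod (g z - g v) * fock_modulus m f v) powr p * exp (- (1 / 8) * (cmod (z - v))\<^sup>2)) \<partial>lebesgue) \<le> ennreal J"
    for g f z J
  proof -
    define a where "a = cmod z ^ m * exp (- (cmod z)\<^sup>2 / 2)"
    have a: "0 < a" using z by (simp add: a_def)
    have le: "cmod (hankel_integrand m g f z v) * a \<le> D * (cmod (g z - g v) * fock_modulus m f v * exp (- (1 / 8) * (cmod (z - v))\<^sup>2))" for v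
    proof -
      have e: "exp (- (cmod v)\<^sup>2) * exp (- (cmod z)\<^sup>2 / 2) = exp (- (cmod v)\<^sup>2 / 2) * exp (- ((cmod z)\<^sup>2 + (cmod v)\<^sup>2) / 2)"
        by (simp flip: exp_add add: field_simps)
      have "cmod (hankel_integrand m g f z v) * a =
          cmod (g z - g v) * cmod (f v) * cmod (kernel m z v) * (cmod v ^ m * cmod v ^ m) * cmod z ^ m * (exp (- (cmod v)\<^sup>2) * exp (- (cmod z)\<^sup>2 / 2))"
        by (simp add: hankel_integrand_def a_def norm_mult norm_power power_mult power2_eq_square power_mult_distrib mult_2 power_add mult_ac)
      also have "\<dots> = cmod (g z - g v) * fock_modulus m f v *
          (cmod z ^ m * cmod v ^ m * cmod (kernel m z v) * exp (- ((cmod z)\<^sup>2 + (cmod v)\<^sup>2) / 2))"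
        unfolding e fock_modulus_def by (simp add: mult_ac)
      also have "\<dots> \<le> cmod (g z - g v) * fock_modulus m f v * (D * exp (- (1 / 8) * (cmod (z - v))\<^sup>2))"
        unfolding D_def by (intro mult_left_mono kernel_weighted_le) (auto simp: fock_modulus_nonneg)
      finally show ?thesis by (simp add: mult_ac)
    qed
    define S where "S = D * (2 * W powr (1 - 1 / p) * J powr (1 / p)) / a"
    have S: "0 \<le> S" using D a by (simp add: S_def)
    have "(\<integral>\<^sup>+v. ennreal (cmod (hankel_integrand m g f z v)) \<partial>lebesgue) \<le>
       (\<integral>\<^sup>+v. ennreal (D / a) * ennreal (cmod (g z - g v) * fock_modulus m f v * exp (- (1 / 8) * (cmod (z - v))\<^sup>2)) \<partial>lebesgue)"
      using le a D fock_modulus_nonneg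
      by (intro nn_integral_mono) (simp add: ennreal_mult[symmetric] ennreal_leI field_simps)
    also have "\<dots> = ennreal (D / a) * (\<integral>\<^sup>+v. ennreal (cmod (g z - g v) * fock_modulus m f v * exp (- (1 / 8) * (cmod (z - v))\<^sup>2)) \<partial>lebesgue)"
      by (rule nn_integral_cmult) measurable
    also have "\<dots> \<le> ennreal (D / a) * ennreal (2 * W powr (1 - 1 / p) * J powr (1 / p))"
      by (intro mult_left_mono nn_integral_powr_Jensen p W(1) J W' int) (auto simp: fock_modulus_nonneg)
    also have "\<dots> = ennreal S" using D a by (simp add: S_def ennreal_mult[symmetric])
    finally have nn: "(\<integral>\<^sup>+v. ennreal (cmod (hankel_integrand m g f z v)) \<partial>lebesgue) \<le> ennreal S" .
    then have integr: "integrable lebesgue (hankel_integrand m g f z)"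
      by (intro integrableI_bounded) (auto intro: order_le_less_trans)
    have "ennreal (cmod (LINT v|lebesgue. hankel_integrand m g f z v)) \<le> ennreal S"
      using integral_norm_bound_ennreal[OF integr] nn by (rule order_trans)
    then have "cmod (LINT v|lebesgue. hankel_integrand m g f z v) \<le> S"
      using S by simp
    then have "cmod (hankel m g f z) \<le> 1 / (pi * fact m) * S"
      by (simp add: hankel_def norm_mult norm_divide divide_right_mono)
    then have "cmod (hankel m g f z) * a \<le> 1 / (pi * fact m) * S * a"
      using a by (intro mult_right_mono) auto
    also have "\<dots> = R * J powr (1 / p)" using a by (simp add: R_def S_def)
    finally have "(cmod (hankel m g f z) * a) powr p \<le> (R * J powr (1 / p)) powr p"
      using a p by (intro powr_mono2) auto
    moreover have "(cmod (hankel m g f z) * a) powr p = cmod (hankel m g f z) powr p * Lweight p m z"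
      using fock_modulus_powr[of m "hankel m g f" z p] by (simp add: fock_modulus_def a_def mult.assoc)
    moreover have "(R * J powr (1 / p)) powr p = R powr p * J"
      using R J p by (simp add: powr_mult powr_powr)
    ultimately show ?thesis using integr by simp
  qed
  then show ?thesis using R by (intro that[of "R powr p"]) auto
qed

context local_Lp
begin

lemma measurable_local_oscillation [measurable]: "local_oscillation c \<in> borel_measurable lebesgue"
  unfolding local_oscillation_def[abs_def] indicator_def mem_cball by measurable

text \<open>
  Replacing \<open>F(v)^p\<close> by its integral over the disc about \<open>v\<close> and exchanging the integrals moves the disc
  from \<open>F\<close> to the symbol, where it smooths \<open>\<integral> |g(z)-g(v)|^p exp(-c|z-v|^2) dA(z)\<close> into
  \<open>local_oscillation\<close>.  Without this step the inner integral would have to be bounded pointwise in \<open>v\<close>,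
  which fails where \<open>g\<close> is locally unbounded.
\<close>

lemma nn_integral_oscillation_le:
  fixes F :: "complex \<Rightarrow> real"
  assumes [measurable]: "F \<in> borel_measurable lebesgue" and F0: "\<And>v. 0 \<le> F v"
    and F: "\<And>v. ennreal (F v powr p) \<le> ennreal C * (\<integral>\<^sup>+w. ennreal (F w powr p) * indicator (cball v r) w \<partial>lebesgue)"
  shows "(\<integral>\<^sup>+z. \<integral>\<^sup>+v. ennreal ((cmod (g z - g v) * F v) powr p * exp (- c * (cmod (z - v))\<^sup>2)) \<partial>lebesgue \<partial>lebesgue)
    \<le> ennreal C * (\<integral>\<^sup>+w. ennreal (F w powr p) * local_oscillation c w \<partial>lebesgue)"
proof -
  define \<Phi> where "\<Phi> = (\<lambda>v. \<integral>\<^sup>+z. ennreal (cmod (g z - g v) powr p * exp (- c * (cmod (z - v))\<^sup>2)) \<partial>lebesgue)"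
  have [measurable]: "\<Phi> \<in> borel_measurable lebesgue"
    unfolding \<Phi>_def by measurable
  have "(\<integral>\<^sup>+z. \<integral>\<^sup>+v. ennreal ((cmod (g z - g v) * F v) powr p * exp (- c * (cmod (z - v))\<^sup>2)) \<partial>lebesgue \<partial>lebesgue) =
     (\<integral>\<^sup>+v. \<integral>\<^sup>+z. ennreal ((cmod (g z - g v) * F v) powr p * exp (- c * (cmod (z - v))\<^sup>2)) \<partial>lebesgue \<partial>lebesgue)"
    by (rule lebesgue_pair.Fubini') measurable
  also have "\<dots> = (\<integral>\<^sup>+v. ennreal (F v powr p) * \<Phi> v \<partial>lebesgue)"
    unfolding \<Phi>_def
  proof (rule nn_integral_cong)
    fix v
    have "(\<integral>\<^sup>+z. ennreal ((cmod (g z - g v) * F v) powr p * exp (- c * (cmod (z - v))\<^sup>2)) \<partial>lebesgue) =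
      (\<integral>\<^sup>+z. ennreal (F v powr p) * ennreal (cmod (g z - g v) powr p * exp (- c * (cmod (z - v))\<^sup>2)) \<partial>lebesgue)"
      by (intro nn_integral_cong) (simp add: powr_mult F0 mult_ac flip: ennreal_mult)
    also have "\<dots> = ennreal (F v powr p) * (\<integral>\<^sup>+z. ennreal (cmod (g z - g v) powr p * exp (- c * (cmod (z - v))\<^sup>2)) \<partial>lebesgue)"
      by (rule nn_integral_cmult) measurable
    finally show "(\<integral>\<^sup>+z. ennreal ((cmod (g z - g v) * F v) powr p * exp (- c * (cmod (z - v))\<^sup>2)) \<partial>lebesgue) =
      ennreal (F v powr p) * (\<integral>\<^sup>+z. ennreal (cmod (g z - g v) powr p * exp (- c * (cmod (z - v))\<^sup>2)) \<partial>lebesgue)" .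
  qed
  also have "\<dots> \<le> (\<integral>\<^sup>+v. ennreal C * (\<integral>\<^sup>+w. ennreal (F w powr p) * indicator (cball v r) w \<partial>lebesgue) * \<Phi> v \<partial>lebesgue)"
    by (intro nn_integral_mono mult_right_mono F) auto
  also have "\<dots> = (\<integral>\<^sup>+v. ennreal C * (\<integral>\<^sup>+w. ennreal (F w powr p) * indicator (cball v r) w * \<Phi> v \<partial>lebesgue) \<partial>lebesgue)"
    by (intro nn_integral_cong) (simp add: mult.assoc[of "ennreal C"] nn_integral_multc)
  also have "\<dots> = ennreal C * (\<integral>\<^sup>+v. \<integral>\<^sup>+w. ennreal (F w powr p) * indicator (cball v r) w * \<Phi> v \<partial>lebesgue \<partial>lebesgue)"
    by (rule nn_integral_cmult) (unfold indicator_def mem_cball, measurable)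
  also have "(\<integral>\<^sup>+v. \<integral>\<^sup>+w. ennreal (F w powr p) * indicator (cball v r) w * \<Phi> v \<partial>lebesgue \<partial>lebesgue) =
     (\<integral>\<^sup>+w. \<integral>\<^sup>+v. ennreal (F w powr p) * indicator (cball v r) w * \<Phi> v \<partial>lebesgue \<partial>lebesgue)"
    by (rule lebesgue_pair.Fubini') (unfold indicator_def mem_cball, measurable)
  also have "\<dots> = (\<integral>\<^sup>+w. ennreal (F w powr p) * local_oscillation c w \<partial>lebesgue)"
  proof (rule nn_integral_cong)
    fix w
    have "(\<integral>\<^sup>+v. ennreal (F w powr p) * indicator (cball v r) w * \<Phi> v \<partial>lebesgue) =
        (\<integral>\<^sup>+v. ennreal (F w powr p) * (\<Phi> v * indicator (cball w r) v) \<partial>lebesgue)"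
      by (intro nn_integral_cong) (simp add: indicator_def dist_commute)
    also have "\<dots> = ennreal (F w powr p) * local_oscillation c w"
      by (subst nn_integral_cmult) (simp_all add: local_oscillation_def \<Phi>_def)
    finally show "(\<integral>\<^sup>+v. ennreal (F w powr p) * indicator (cball v r) w * \<Phi> v \<partial>lebesgue) = ennreal (F w powr p) * local_oscillation c w" .
  qed
  finally show ?thesis .
qed

lemma hankel_norm_bound:
  obtains K where "0 < K"
    "\<And>f. f holomorphic_on UNIV \<Longrightarrow>
      (\<integral>\<^sup>+w. ennreal (fock_modulus m f w powr p) * local_oscillation (1 / 8) w \<partial>lebesgue) < \<infinity> \<Longrightarrow>
      (AE z in lebesgue. integrable lebesgue (hankel_integrand m g f z)) \<and>
      (\<integral>\<^sup>+z. ennreal (cmod (hankel m g f z) powr p * Lweight p m z) \<partial>lebesgue)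
        \<le> ennreal K * (\<integral>\<^sup>+w. ennreal (fock_modulus m f w powr p) * local_oscillation (1 / 8) w \<partial>lebesgue)"
proof -
  obtain Q where Q: "0 < Q"
    "\<And>g f z J. g \<in> borel_measurable lebesgue \<Longrightarrow> f \<in> borel_measurable lebesgue \<Longrightarrow> z \<noteq> 0 \<Longrightarrow> 0 \<le> J \<Longrightarrow>
      (\<integral>\<^sup>+v. ennreal ((cmod (g z - g v) * fock_modulus m f v) powr p * exp (- (1 / 8) * (cmod (z - v))\<^sup>2)) \<partial>lebesgue) \<le> ennreal J \<Longrightarrow>
      integrable lebesgue (hankel_integrand m g f z) \<and>
      cmod (hankel m g f z) powr p * Lweight p m z \<le> Q * J"
    using hankel_pointwise_bound[OF p_ge_1] by blast
  obtain C where C: "0 < C"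
    "\<And>f v. f holomorphic_on UNIV \<Longrightarrow> ennreal (fock_modulus m f v powr p) \<le>
      ennreal C * (\<integral>\<^sup>+w. ennreal (fock_modulus m f w powr p) * indicator (cball v r) w \<partial>lebesgue)"
    using fock_modulus_powr_le_integral[OF r_pos p_ge_1] by blast
  have "(AE z in lebesgue. integrable lebesgue (hankel_integrand m g f z)) \<and>
      (\<integral>\<^sup>+z. ennreal (cmod (hankel m g f z) powr p * Lweight p m z) \<partial>lebesgue)
        \<le> ennreal (Q * C) * (\<integral>\<^sup>+w. ennreal (fock_modulus m f w powr p) * local_oscillation (1 / 8) w \<partial>lebesgue)"
    if hol: "f holomorphic_on UNIV"
      and fin: "(\<integral>\<^sup>+w. ennreal (fock_modulus m f w powr p) * local_oscillation (1 / 8) w \<partial>lebesgue) < \<infinity>" (is "?L < _") for f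
  proof -
    note [measurable] = measurable_entire[OF hol]
    define J where "J = (\<lambda>z. \<integral>\<^sup>+v. ennreal ((cmod (g z - g v) * fock_modulus m f v) powr p * exp (- (1 / 8) * (cmod (z - v))\<^sup>2)) \<partial>lebesgue)"
    have [measurable]: "J \<in> borel_measurable lebesgue" unfolding J_def by measurable
    have J: "(\<integral>\<^sup>+z. J z \<partial>lebesgue) \<le> ennreal C * ?L"
      unfolding J_def
      by (rule nn_integral_oscillation_le) (auto simp: fock_modulus_nonneg intro: C(2)[OF hol])
    also have "\<dots> < \<infinity>" using fin by (simp add: ennreal_mult_less_top)
    finally have "AE z in lebesgue. J z \<noteq> \<infinity>"
      by (intro nn_integral_PInf_AE) auto
    moreover have "AE z in lebesgue. z \<noteq> (0::complex)"
      by (rule AE_completion) (rule AE_lborel_singleton)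
    ultimately have AE: "AE z in lebesgue. integrable lebesgue (hankel_integrand m g f z) \<and>
        ennreal (cmod (hankel m g f z) powr p * Lweight p m z) \<le> ennreal Q * J z"
    proof eventually_elim
      case (elim z)
      then have Jz: "J z = ennreal (enn2real (J z))" by (simp add: less_top)
      have "integrable lebesgue (hankel_integrand m g f z) \<and> cmod (hankel m g f z) powr p * Lweight p m z \<le> Q * enn2real (J z)"
        using elim Jz by (intro Q(2)) (auto simp: J_def)
      then show ?case
        by (subst Jz) (use Q(1) in \<open>simp add: ennreal_mult[symmetric] ennreal_leI\<close>)
    qed
    have "(\<integral>\<^sup>+z. ennreal (cmod (hankel m g f z) powr p * Lweight p m z) \<partial>lebesgue) \<le> (\<integral>\<^sup>+z. ennreal Q * J z \<partial>lebesgue)"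
      using AE by (intro nn_integral_mono_AE) auto
    also have "\<dots> = ennreal Q * (\<integral>\<^sup>+z. J z \<partial>lebesgue)" by (rule nn_integral_cmult) measurable
    also have "\<dots> \<le> ennreal Q * (ennreal C * ?L)" by (rule mult_left_mono[OF J]) simp
    also have "\<dots> = ennreal (Q * C) * ?L" using Q C by (simp add: ennreal_mult mult.assoc)
    finally show ?thesis using AE by auto
  qed
  then show ?thesis using Q(1) C(1) by (intro that[of "Q * C"]) auto
qed

end

section \<open>Normal families in the Fock-Sobolev space\<close>

lemma omega_pos:
  assumes "0 < p"
  shows "0 < omega p m"
proof -
  have "0 < Gamma (real m * p / 2 + 1)"
    using assms by (intro Gamma_real_pos) (simp add: add_nonneg_pos)
  then show ?thesis using assms by (simp add: omega_def)
qed

lemma Lspace_iff: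
  "f \<in> Lspace p m \<longleftrightarrow> f \<in> borel_measurable lebesgue \<and>
     (\<integral>\<^sup>+v. ennreal (fock_modulus m f v powr p) \<partial>lebesgue) < \<infinity>"
proof (cases "f \<in> borel_measurable lebesgue")
  case True
  note [measurable] = True
  have "integrable lebesgue (\<lambda>v. fock_modulus m f v powr p) \<longleftrightarrow>
     (\<integral>\<^sup>+v. ennreal (fock_modulus m f v powr p) \<partial>lebesgue) < \<infinity>"
    by (subst integrable_iff_bounded) simp
  then show ?thesis using True by (simp add: Lspace_def fock_modulus_powr)
qed (simp add: Lspace_def)

lemma Fock_Sobolev_iff:
  "f \<in> Fock_Sobolev p m \<longleftrightarrow> f holomorphic_on UNIV \<and>
     (\<integral>\<^sup>+v. ennreal (fock_modulus m f v powr p) \<partial>lebesgue) < \<infinity>"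
  using measurable_entire by (auto simp: Fock_Sobolev_def Lspace_iff)

lemma Lnorm_eq:
  assumes [measurable]: "f \<in> borel_measurable lebesgue"
  shows "Lnorm p m f = (omega p m * enn2real (\<integral>\<^sup>+v. ennreal (fock_modulus m f v powr p) \<partial>lebesgue)) powr (1 / p)"
  unfolding Lnorm_def fock_modulus_powr[symmetric]
  by (subst integral_eq_nn_integral) auto

lemma nn_integral_le_Lnorm:
  assumes f: "f \<in> Lspace p m" and p: "1 \<le> p" and C: "Lnorm p m f \<le> C"
  shows "(\<integral>\<^sup>+v. ennreal (fock_modulus m f v powr p) \<partial>lebesgue) \<le> ennreal (C powr p / omega p m)"
proof -
  have [measurable]: "f \<in> borel_measurable lebesgue" using f by (simp add: Lspace_iff)
  define I where "I = enn2real (\<integral>\<^sup>+v. ennreal (fock_modulus m f v powr p) \<partial>lebesgue)"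
  have I: "(\<integral>\<^sup>+v. ennreal (fock_modulus m f v powr p) \<partial>lebesgue) = ennreal I"
    using f by (simp add: I_def Lspace_iff)
  have om: "0 < omega p m" using p by (intro omega_pos) auto
  have "omega p m * I = Lnorm p m f powr p"
    using p om by (simp add: Lnorm_eq powr_powr I_def)
  also have "\<dots> \<le> C powr p"
    using C p by (intro powr_mono2) (auto simp: Lnorm_def)
  finally have "I \<le> C powr p / omega p m" using om by (simp add: field_simps)
  then show ?thesis unfolding I by (rule ennreal_leI)
qed

lemma nn_integral_fock_modulus_diff_le:
  assumes p: "1 \<le> p" and [measurable]: "f \<in> borel_measurable lebesgue" "h \<in> borel_measurable lebesgue"
  shows "(\<integral>\<^sup>+v. ennreal (fock_modulus m (\<lambda>z. f z - h z) v powr p) \<partial>lebesgue) \<le>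
    ennreal (2 powr p) * ((\<integral>\<^sup>+v. ennreal (fock_modulus m f v powr p) \<partial>lebesgue) + (\<integral>\<^sup>+v. ennreal (fock_modulus m h v powr p) \<partial>lebesgue))"
proof -
  have "(\<integral>\<^sup>+v. ennreal (fock_modulus m (\<lambda>z. f z - h z) v powr p) \<partial>lebesgue) \<le>
     (\<integral>\<^sup>+v. ennreal (2 powr p) * (ennreal (fock_modulus m f v powr p) + ennreal (fock_modulus m h v powr p)) \<partial>lebesgue)"
  proof (rule nn_integral_mono)
    fix v
    have "fock_modulus m (\<lambda>z. f z - h z) v \<le> fock_modulus m f v + fock_modulus m h v"
      using mult_right_mono[OF norm_triangle_ineq4[of "f v" "h v"], of "cmod v ^ m * exp (- (cmod v)\<^sup>2 / 2)"]
      by (simp add: fock_modulus_def algebra_simps)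
    then have "fock_modulus m (\<lambda>z. f z - h z) v powr p \<le> (fock_modulus m f v + fock_modulus m h v) powr p"
      using p by (intro powr_mono2 fock_modulus_nonneg) auto
    also have "\<dots> \<le> 2 powr p * (fock_modulus m f v powr p + fock_modulus m h v powr p)"
      using p by (intro powr_add_le fock_modulus_nonneg) auto
    finally show "ennreal (fock_modulus m (\<lambda>z. f z - h z) v powr p) \<le>
       ennreal (2 powr p) * (ennreal (fock_modulus m f v powr p) + ennreal (fock_modulus m h v powr p))"
      by (simp add: ennreal_mult[symmetric] ennreal_plus[symmetric] ennreal_leI del: ennreal_plus)
  qed
  also have "\<dots> = ennreal (2 powr p) * ((\<integral>\<^sup>+v. ennreal (fock_modulus m f v powr p) \<partial>lebesgue) + (\<integral>\<^sup>+v. ennreal (fock_modulus m h v powr p) \<partial>lebesgue))"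
    by (simp add: nn_integral_cmult nn_integral_add)
  finally show ?thesis .
qed

text \<open>
  The weighted modulus is bounded by the norm at every point.  As \<open>|v|^m\<close> degenerates at the origin, the
  bound for \<open>f\<close> is read off on a circle of radius at least \<open>1\<close> and carried inside by the maximum principle.
\<close>

lemma Fock_Sobolev_locally_bounded:
  assumes p: "1 \<le> p"
  obtains A where
    "\<And>f z. f holomorphic_on UNIV \<Longrightarrow> (\<integral>\<^sup>+v. ennreal (fock_modulus m f v powr p) \<partial>lebesgue) \<le> ennreal B \<Longrightarrow>
       cmod z \<le> \<rho> \<Longrightarrow> cmod (f z) \<le> A"
proof -
  obtain C where C: "0 < C" "\<And>f v. f holomorphic_on UNIV \<Longrightarrow> ennreal (fock_modulus m f v powr p) \<le>
      ennreal C * (\<integral>\<^sup>+w. ennreal (fock_modulus m f w powr p) * indicator (cball v 1) w \<partial>lebesgue)"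
    using fock_modulus_powr_le_integral[of 1 p m] p by auto
  define \<sigma> where "\<sigma> = max 0 \<rho> + 1"
  define b where "b = (C * max 0 B) powr (1 / p)"
  have "cmod (f z) \<le> b * exp (\<sigma>\<^sup>2 / 2)"
    if hol: "f holomorphic_on UNIV" and int: "(\<integral>\<^sup>+v. ennreal (fock_modulus m f v powr p) \<partial>lebesgue) \<le> ennreal B"
      and z: "cmod z \<le> \<rho>" for f z
  proof -
    have U: "fock_modulus m f v \<le> b" for v
    proof -
      have "ennreal (fock_modulus m f v powr p) \<le> ennreal C * (\<integral>\<^sup>+w. ennreal (fock_modulus m f w powr p) * indicator (cball v 1) w \<partial>lebesgue)"
        by (rule C(2)[OF hol])
      also have "\<dots> \<le> ennreal C * (\<integral>\<^sup>+w. ennreal (fock_modulus m f w powr p) \<partial>lebesgue)"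
        by (intro mult_left_mono nn_integral_mono) (auto simp: indicator_def)
      also have "\<dots> \<le> ennreal C * ennreal (max 0 B)"
        by (intro mult_left_mono order_trans[OF int] ennreal_leI) auto
      also have "\<dots> = ennreal (C * max 0 B)" using C by (simp add: ennreal_mult)
      finally have "fock_modulus m f v powr p \<le> C * max 0 B"
        using C by (subst (asm) ennreal_le_iff) auto
      then have "(fock_modulus m f v powr p) powr (1 / p) \<le> b"
        unfolding b_def using p by (intro powr_mono2) auto
      then show ?thesis using p by (simp add: powr_powr fock_modulus_nonneg)
    qed
    have \<sigma>: "1 \<le> \<sigma>" "\<rho> < \<sigma>" by (auto simp: \<sigma>_def)
    show ?thesis
    proof (rule maximum_modulus_frontier[of f "cball 0 \<sigma>"])
      fix v :: complex assume "v \<in> frontier (cball 0 \<sigma>)"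
      then have v: "cmod v = \<sigma>" using \<sigma> by (simp add: frontier_cball)
      have "cmod (f v) * 1 \<le> cmod (f v) * \<sigma> ^ m"
        using \<sigma> by (intro mult_left_mono) auto
      then have "cmod (f v) * exp (- \<sigma>\<^sup>2 / 2) \<le> fock_modulus m f v"
        unfolding fock_modulus_def v by (intro mult_right_mono) auto
      then have "cmod (f v) * exp (- \<sigma>\<^sup>2 / 2) * exp (\<sigma>\<^sup>2 / 2) \<le> b * exp (\<sigma>\<^sup>2 / 2)"
        using U[of v] by (intro mult_right_mono) auto
      then show "cmod (f v) \<le> b * exp (\<sigma>\<^sup>2 / 2)"
        by (simp add: mult.assoc flip: exp_add)
    next
      show "continuous_on (closure (cball 0 \<sigma>)) f"
        using holomorphic_on_imp_continuous_on[OF hol] continuous_on_subset by blast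
    qed (use hol holomorphic_on_subset z \<sigma> in auto)
  qed
  then show ?thesis by (rule that)
qed

lemma Fock_Sobolev_Montel:
  assumes p: "1 \<le> p" and hol: "\<And>n. f n holomorphic_on UNIV"
    and B: "\<And>n. (\<integral>\<^sup>+v. ennreal (fock_modulus m (f n) v powr p) \<partial>lebesgue) \<le> ennreal B"
  obtains h s where "h holomorphic_on UNIV" "strict_mono (s :: nat \<Rightarrow> nat)"
    "(\<integral>\<^sup>+v. ennreal (fock_modulus m h v powr p) \<partial>lebesgue) \<le> ennreal B"
    "\<And>K. compact K \<Longrightarrow> uniform_limit K (\<lambda>n. f (s n)) h sequentially"
proof -
  have bounded: "\<exists>A. \<forall>h\<in>range f. \<forall>z\<in>K. cmod (h z) \<le> A" if K: "compact K" for K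
  proof -
    obtain \<rho> where \<rho>: "\<And>z. z \<in> K \<Longrightarrow> cmod z \<le> \<rho>"
      using compact_imp_bounded[OF K] by (auto simp: bounded_iff)
    show ?thesis
      by (rule Fock_Sobolev_locally_bounded[OF p, of m B \<rho>]) (use hol B \<rho> in blast)
  qed
  obtain h s where h: "h holomorphic_on UNIV" "strict_mono (s :: nat \<Rightarrow> nat)"
      "\<And>x. x \<in> UNIV \<Longrightarrow> ((\<lambda>n. f (s n) x) \<longlongrightarrow> h x) sequentially"
      "\<And>K. compact K \<Longrightarrow> K \<subseteq> UNIV \<Longrightarrow> uniform_limit K (f \<circ> s) h sequentially"
  proof (rule Montel[of UNIV "range f" f])
    show "\<exists>A. \<forall>h\<in>range f. \<forall>z\<in>K. cmod (h z) \<le> A" if "compact K" for K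
      by (rule bounded[OF that])
  qed (use hol in auto)
  have [measurable]: "f n \<in> borel_measurable lebesgue" for n by (rule measurable_entire[OF hol])
  have "(\<integral>\<^sup>+v. ennreal (fock_modulus m h v powr p) \<partial>lebesgue) =
      (\<integral>\<^sup>+v. liminf (\<lambda>n. ennreal (fock_modulus m (f (s n)) v powr p)) \<partial>lebesgue)"
  proof (rule nn_integral_cong)
    fix v
    have "(\<lambda>n. fock_modulus m (f (s n)) v powr p) \<longlonglongrightarrow> fock_modulus m h v powr p"
      unfolding fock_modulus_def using p h(3)[of v]
      by (intro tendsto_powr' tendsto_intros) auto
    then have "(\<lambda>n. ennreal (fock_modulus m (f (s n)) v powr p)) \<longlonglongrightarrow> ennreal (fock_modulus m h v powr p)"
      by (rule tendsto_ennrealI)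
    then show "ennreal (fock_modulus m h v powr p) = liminf (\<lambda>n. ennreal (fock_modulus m (f (s n)) v powr p))"
      using lim_imp_Liminf[of sequentially] by (metis trivial_limit_sequentially)
  qed
  also have "\<dots> \<le> liminf (\<lambda>n. \<integral>\<^sup>+v. ennreal (fock_modulus m (f (s n)) v powr p) \<partial>lebesgue)"
    by (rule nn_integral_liminf) measurable
  also have "\<dots> \<le> ennreal B"
    by (rule order_trans[OF Liminf_mono[of _ "\<lambda>_. ennreal B"]]) (auto simp: B Liminf_const)
  finally show ?thesis using h by (intro that[of h s]) (auto simp: comp_def)
qed

section \<open>Compactness\<close>

lemma hankel_diff:
  assumes "integrable lebesgue (hankel_integrand m g f z)" "integrable lebesgue (hankel_integrand m g h z)"
  shows "hankel m g (\<lambda>z. f z - h z) z = hankel m g f z - hankel m g h z"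
proof -
  have "hankel_integrand m g (\<lambda>z. f z - h z) z = (\<lambda>v. hankel_integrand m g f z v - hankel_integrand m g h z v)"
    by (auto simp: hankel_integrand_def algebra_simps)
  then show ?thesis
    using assms by (simp add: hankel_def right_diff_distrib)
qed

context local_Lp
begin

lemma local_oscillation_bounded:
  assumes "(osc \<longlongrightarrow> 0) at_infinity" "0 < c"
  obtains M where "0 < M" "\<And>w. local_oscillation c w \<le> ennreal M"
proof -
  obtain C where C: "0 < C"
    "\<And>w \<epsilon>. (\<And>x. osc (w + x) \<le> \<epsilon> * (1 + cmod x)) \<Longrightarrow> local_oscillation c w \<le> ennreal (C * \<epsilon> powr p)"
    using local_oscillation_le[OF assms(2)] by blast
  obtain M where M: "0 < M" "\<And>z. osc z \<le> M" using osc_bounded[OF assms(1)] by blast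
  have "osc (w + x) \<le> M * (1 + cmod x)" for w x
    using M(1) M(2)[of "w + x"] by (simp add: distrib_left add_increasing2)
  then show ?thesis using C M by (intro that[of "C * M powr p"]) auto
qed

lemma local_oscillation_vanishes:
  assumes "(osc \<longlongrightarrow> 0) at_infinity" "0 < c" "0 < \<epsilon>"
  obtains R where "0 < R" "\<And>w. R \<le> cmod w \<Longrightarrow> local_oscillation c w \<le> ennreal \<epsilon>"
proof -
  obtain C where C: "0 < C"
    "\<And>w \<epsilon>. (\<And>x. osc (w + x) \<le> \<epsilon> * (1 + cmod x)) \<Longrightarrow> local_oscillation c w \<le> ennreal (C * \<epsilon> powr p)"
    using local_oscillation_le[OF assms(2)] by blast
  define \<delta> where "\<delta> = (\<epsilon> / C) powr (1 / p)"
  have \<delta>: "0 < \<delta>" "C * \<delta> powr p = \<epsilon>"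
    using assms C p_ge_1 by (auto simp: \<delta>_def powr_powr)
  obtain R where R: "\<And>w x. R \<le> cmod w \<Longrightarrow> osc (w + x) \<le> \<delta> * (1 + cmod x)"
    using osc_translate_le[OF assms(1) \<delta>(1)] by blast
  have "local_oscillation c w \<le> ennreal \<epsilon>" if "max 1 R \<le> cmod w" for w
    using C(2)[of w \<delta>] R[of w] that \<delta>(2) by simp
  then show ?thesis by (intro that[of "max 1 R"]) auto
qed

text \<open>
  A bounded sequence tending to \<open>0\<close> locally uniformly tends to \<open>0\<close> in norm against a bounded density that
  vanishes at infinity: the disc of radius \<open>R\<close> and its complement each contribute at most \<open>e/2\<close>.
\<close>

lemma eventually_weighted_integral_small:
  assumes lim: "(osc \<longlongrightarrow> 0) at_infinity" and c: "0 < c" and e: "0 < e"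
    and [measurable]: "\<And>n. u n \<in> borel_measurable lebesgue"
    and B: "\<And>n. (\<integral>\<^sup>+v. ennreal (fock_modulus m (u n) v powr p) \<partial>lebesgue) \<le> ennreal B" "0 < B"
    and u: "\<And>K. compact K \<Longrightarrow> uniform_limit K u (\<lambda>_. 0) sequentially"
  shows "eventually (\<lambda>n. (\<integral>\<^sup>+w. ennreal (fock_modulus m (u n) w powr p) * local_oscillation c w \<partial>lebesgue) \<le> ennreal e) sequentially"
proof -
  obtain M where M: "0 < M" "\<And>w. local_oscillation c w \<le> ennreal M"
    using local_oscillation_bounded[OF lim c] by blast
  define \<epsilon> where "\<epsilon> = e / (2 * B)"
  have \<epsilon>: "0 < \<epsilon>" using e B by (simp add: \<epsilon>_def)
  obtain R where R: "0 < R" "\<And>w. R \<le> cmod w \<Longrightarrow> local_oscillation c w \<le> ennreal \<epsilon>"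
    using local_oscillation_vanishes[OF lim c \<epsilon>] by blast
  \<comment> \<open>chosen so that the disc of radius \<open>R\<close> contributes exactly \<open>e / 2\<close>\<close>
  define \<eta> where "\<eta> = (e / (2 * (M * (pi * R\<^sup>2)))) powr (1 / p)"
  have \<eta>: "0 < \<eta>" "\<eta> powr p * M * (pi * R\<^sup>2) = e / 2"
    using e M R p_ge_1 by (auto simp: \<eta>_def powr_powr)
  have "0 < \<eta> / (1 + R) ^ m" using \<eta> R by simp
  then have "eventually (\<lambda>n. \<forall>w\<in>cball 0 R. dist (u n w) 0 < \<eta> / (1 + R) ^ m) sequentially"
    using u[of "cball 0 R"] by (simp add: uniform_limit_iff)
  then show ?thesis
  proof eventually_elim
    case (elim n)
    have near: "fock_modulus m (u n) w powr p \<le> \<eta> powr p" if w: "cmod w \<le> R" for w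
    proof -
      have "fock_modulus m (u n) w \<le> (\<eta> / (1 + R) ^ m) * (1 + R) ^ m * 1"
        unfolding fock_modulus_def using elim w R \<eta>
        by (intro mult_mono power_mono) (auto simp: dist_norm less_imp_le)
      then have "fock_modulus m (u n) w \<le> \<eta>" using R by simp
      then show ?thesis using p_ge_1 by (intro powr_mono2 fock_modulus_nonneg) auto
    qed
    have "(\<integral>\<^sup>+w. ennreal (fock_modulus m (u n) w powr p) * local_oscillation c w \<partial>lebesgue) \<le>
       (\<integral>\<^sup>+w. ennreal (\<eta> powr p * M) * indicator (cball 0 R) w + ennreal \<epsilon> * ennreal (fock_modulus m (u n) w powr p) \<partial>lebesgue)"
    proof (rule nn_integral_mono)
      fix w
      show "ennreal (fock_modulus m (u n) w powr p) * local_oscillation c w \<le>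
        ennreal (\<eta> powr p * M) * indicator (cball 0 R) w + ennreal \<epsilon> * ennreal (fock_modulus m (u n) w powr p)"
      proof (cases "cmod w \<le> R")
        case True
        have "ennreal (fock_modulus m (u n) w powr p) * local_oscillation c w \<le> ennreal (\<eta> powr p) * ennreal M"
          by (intro mult_mono M ennreal_leI near True) auto
        then show ?thesis using True M by (simp add: ennreal_mult add_increasing2)
      next
        case False
        then have "ennreal (fock_modulus m (u n) w powr p) * local_oscillation c w \<le> ennreal (fock_modulus m (u n) w powr p) * ennreal \<epsilon>"
          by (intro mult_left_mono R) auto
        then show ?thesis using False by (simp add: mult.commute)
      qed
    qed
    also have "\<dots> = ennreal (\<eta> powr p * M) * ennreal (pi * R\<^sup>2) + ennreal \<epsilon> * (\<integral>\<^sup>+w. ennreal (fock_modulus m (u n) w powr p) \<partial>lebesgue)"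
      using R by (simp add: nn_integral_add nn_integral_cmult nn_integral_cmult_indicator emeasure_cball_complex)
    also have "\<dots> \<le> ennreal (\<eta> powr p * M) * ennreal (pi * R\<^sup>2) + ennreal \<epsilon> * ennreal B"
      by (intro add_left_mono mult_left_mono B) auto
    also have "\<dots> = ennreal (\<eta> powr p * M * (pi * R\<^sup>2) + \<epsilon> * B)"
      using M \<epsilon> B R by (simp add: ennreal_mult ennreal_plus)
    also have "\<eta> powr p * M * (pi * R\<^sup>2) + \<epsilon> * B = e"
      using B unfolding \<eta>(2) by (simp add: \<epsilon>_def)
    finally show ?case .
  qed
qed

lemma compact_hankel:
  assumes lim: "(osc \<longlongrightarrow> 0) at_infinity"
  shows "compact_operator p m (hankel_domain p m g) (hankel m g)"
proof -
  define L where "L = (\<lambda>f. \<integral>\<^sup>+w. ennreal (fock_modulus m f w powr p) * local_oscillation (1 / 8) w \<partial>lebesgue)"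
  obtain K where K: "0 < K"
    "\<And>f. f holomorphic_on UNIV \<Longrightarrow> L f < \<infinity> \<Longrightarrow>
      (AE z in lebesgue. integrable lebesgue (hankel_integrand m g f z)) \<and>
      (\<integral>\<^sup>+z. ennreal (cmod (hankel m g f z) powr p * Lweight p m z) \<partial>lebesgue) \<le> ennreal K * L f"
    using hankel_norm_bound[of m] unfolding L_def by blast
  obtain M where M: "0 < M" "\<And>w. local_oscillation (1 / 8) w \<le> ennreal M"
    using local_oscillation_bounded[OF lim, of "1 / 8"] by auto
  have L_fin: "L f < \<infinity>" if "f \<in> Fock_Sobolev p m" for f
  proof -
    have [measurable]: "f \<in> borel_measurable lebesgue"
      using that by (auto simp: Fock_Sobolev_def Lspace_def)
    have "L f \<le> (\<integral>\<^sup>+w. ennreal (fock_modulus m f w powr p) * ennreal M \<partial>lebesgue)"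
      unfolding L_def by (intro nn_integral_mono mult_left_mono M) auto
    also have "\<dots> = (\<integral>\<^sup>+w. ennreal (fock_modulus m f w powr p) \<partial>lebesgue) * ennreal M"
      by (rule nn_integral_multc) measurable
    also have "\<dots> < \<infinity>" using that by (simp add: Fock_Sobolev_iff ennreal_mult_less_top)
    finally show ?thesis .
  qed
  have hol: "f holomorphic_on UNIV" if "f \<in> Fock_Sobolev p m" for f
    using that by (simp add: Fock_Sobolev_def)
  have AE_int: "AE z in lebesgue. integrable lebesgue (hankel_integrand m g f z)"
    if "f \<in> Fock_Sobolev p m" for f using K(2)[OF hol L_fin] that by blast
  have bound: "(\<integral>\<^sup>+z. ennreal (fock_modulus m (hankel m g f) z powr p) \<partial>lebesgue) \<le> ennreal K * L f"
    if "f \<in> Fock_Sobolev p m" for f using K(2)[OF hol L_fin] that by (simp add: fock_modulus_powr)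
  have dom: "hankel_domain p m g = Fock_Sobolev p m"
    using AE_int by (auto simp: hankel_domain_def)
  have range: "hankel m g f \<in> Lspace p m" if "f \<in> Fock_Sobolev p m" for f
  proof -
    have [measurable]: "f \<in> borel_measurable lebesgue" by (rule measurable_entire[OF hol[OF that]])
    show ?thesis
      using order_le_less_trans[OF bound[OF that]] L_fin[OF that]
      by (simp add: Lspace_iff ennreal_mult_less_top)
  qed
  have "\<exists>h\<in>Lspace p m. \<exists>s::nat \<Rightarrow> nat. strict_mono s \<and>
           (\<lambda>n. Lnorm p m (\<lambda>z. hankel m g (f (s n)) z - h z)) \<longlonglongrightarrow> 0"
    if f: "\<And>n. f n \<in> Fock_Sobolev p m" "\<And>n. Lnorm p m (f n) \<le> C" for f C
  proof -
    define B where "B = C powr p / omega p m"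
    have B: "(\<integral>\<^sup>+v. ennreal (fock_modulus m (f n) v powr p) \<partial>lebesgue) \<le> ennreal B" for n
      unfolding B_def using f p_ge_1 by (intro nn_integral_le_Lnorm) (auto simp: Fock_Sobolev_def)
    have om: "0 < omega p m" using p_ge_1 by (intro omega_pos) auto
    have B0: "0 \<le> B" using om by (simp add: B_def)
    obtain h s where hs: "h holomorphic_on UNIV" "strict_mono (s :: nat \<Rightarrow> nat)"
      "(\<integral>\<^sup>+v. ennreal (fock_modulus m h v powr p) \<partial>lebesgue) \<le> ennreal B"
      "\<And>K. compact K \<Longrightarrow> uniform_limit K (\<lambda>n. f (s n)) h sequentially"
      using Fock_Sobolev_Montel[of p f m B, OF p_ge_1 hol[OF f(1)] B] by metis
    have h: "h \<in> Fock_Sobolev p m"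
      using hs(1) order_le_less_trans[OF hs(3) ennreal_less_top] by (simp add: Fock_Sobolev_iff)
    note [measurable] = measurable_entire[OF hol[OF f(1)]] measurable_entire[OF hs(1)]
    define u where "u = (\<lambda>n z. f (s n) z - h z)"
    have [measurable]: "u n \<in> borel_measurable lebesgue" for n unfolding u_def by measurable
    \<comment> \<open>the summand \<open>1\<close> only makes the bound strictly positive when \<open>B = 0\<close>\<close>
    have u_int: "(\<integral>\<^sup>+v. ennreal (fock_modulus m (u n) v powr p) \<partial>lebesgue) \<le> ennreal (2 powr p * (B + B) + 1)" for n
    proof -
      have "(\<integral>\<^sup>+v. ennreal (fock_modulus m (u n) v powr p) \<partial>lebesgue) \<le> ennreal (2 powr p) * (ennreal B + ennreal B)"
        unfolding u_def
        by (rule order_trans[OF nn_integral_fock_modulus_diff_le[OF p_ge_1]])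
          (auto intro!: mult_left_mono add_mono B hs(3))
      also have "\<dots> = ennreal (2 powr p * (B + B))"
        using B0 by (simp add: ennreal_mult[symmetric] ennreal_plus[symmetric] del: ennreal_plus)
      also have "\<dots> \<le> ennreal (2 powr p * (B + B) + 1)" by (intro ennreal_leI) simp
      finally show ?thesis .
    qed
    have u: "u n \<in> Fock_Sobolev p m" for n
      using order_le_less_trans[OF u_int[of n] ennreal_less_top] hol[OF f(1)] hs(1)
      by (auto simp: Fock_Sobolev_iff u_def intro!: holomorphic_intros)
    have u_lim: "uniform_limit X u (\<lambda>_. 0) sequentially" if "compact X" for X
      using hs(4)[OF that] by (simp add: uniform_limit_iff u_def dist_norm)
    have norm_eq: "Lnorm p m (\<lambda>z. hankel m g (f (s n)) z - hankel m g h z) =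
        (omega p m * enn2real (\<integral>\<^sup>+z. ennreal (fock_modulus m (hankel m g (u n)) z powr p) \<partial>lebesgue)) powr (1 / p)" for n
    proof -
      have "AE z in lebesgue. hankel m g (u n) z = hankel m g (f (s n)) z - hankel m g h z"
        using AE_int[OF f(1)[of "s n"]] AE_int[OF h] unfolding u_def
        by eventually_elim (rule hankel_diff)
      then have "(\<integral>\<^sup>+z. ennreal (fock_modulus m (hankel m g (u n)) z powr p) \<partial>lebesgue) =
        (\<integral>\<^sup>+z. ennreal (fock_modulus m (\<lambda>z. hankel m g (f (s n)) z - hankel m g h z) z powr p) \<partial>lebesgue)"
        by (intro nn_integral_cong_AE) (auto simp: fock_modulus_def)
      then show ?thesis by (subst Lnorm_eq) auto
    qed
    have "(\<lambda>n. enn2real (\<integral>\<^sup>+z. ennreal (fock_modulus m (hankel m g (u n)) z powr p) \<partial>lebesgue)) \<longlonglongrightarrow> 0"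
    proof (rule tendstoI)
      fix e :: real assume e: "0 < e"
      have "eventually (\<lambda>n. L (u n) \<le> ennreal (e / (2 * K))) sequentially"
        unfolding L_def using e K B0 u_int u_lim
        by (intro eventually_weighted_integral_small[where B="2 powr p * (B + B) + 1"] lim)
          (auto intro: add_nonneg_pos)
      then show "eventually (\<lambda>n. dist (enn2real (\<integral>\<^sup>+z. ennreal (fock_modulus m (hankel m g (u n)) z powr p) \<partial>lebesgue)) 0 < e) sequentially"
      proof eventually_elim
        case (elim n)
        have "(\<integral>\<^sup>+z. ennreal (fock_modulus m (hankel m g (u n)) z powr p) \<partial>lebesgue) \<le> ennreal K * ennreal (e / (2 * K))"
          using bound[OF u] mult_left_mono[OF elim, of "ennreal K"] by (rule order_trans) simp
        also have "\<dots> = ennreal (e / 2)" using K e by (simp add: ennreal_mult[symmetric])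
        finally have "enn2real (\<integral>\<^sup>+z. ennreal (fock_modulus m (hankel m g (u n)) z powr p) \<partial>lebesgue) \<le> e / 2"
          using e by (intro enn2real_leI) auto
        then show ?case using e by simp
      qed
    qed
    then have "(\<lambda>n. Lnorm p m (\<lambda>z. hankel m g (f (s n)) z - hankel m g h z)) \<longlonglongrightarrow> (omega p m * 0) powr (1 / p)"
      unfolding norm_eq using p_ge_1 om
      by (intro tendsto_powr' tendsto_mult tendsto_const) auto
    then show ?thesis using range[OF h] hs(2) by auto
  qed
  then show ?thesis unfolding compact_operator_def dom using range by blast
qed

end

lemma VMO_cnj:
  assumes "g \<in> VMO p"
  shows "(\<lambda>v. cnj (g v)) \<in> VMO p"
proof -
  obtain r where r: "0 < r" "g \<in> Lp_loc p" "(mean_oscillation p r g \<longlongrightarrow> 0) at_infinity"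
    using assms by (auto simp: VMO_def VMO_r_def)
  have avg: "ball_average r (\<lambda>v. cnj (g v)) z = cnj (ball_average r g z)" for z
    by (simp add: ball_average_def set_lebesgue_integral_def flip: complex_cnj_scaleR integral_cnj)
  have "mean_oscillation p r (\<lambda>v. cnj (g v)) = mean_oscillation p r g"
    unfolding mean_oscillation_def avg complex_cnj_diff[symmetric] complex_mod_cnj ..
  moreover have "(\<lambda>v. cnj (g v)) \<in> Lp_loc p"
    using r(2) by (auto simp: Lp_loc_def)
  ultimately show ?thesis
    using r unfolding VMO_def VMO_r_def by (intro UN_I[of r]) auto
qed

lemma compact_hankel_VMO:
  assumes "1 \<le> p" "g \<in> VMO p"
  shows "compact_operator p m (hankel_domain p m g) (hankel m g)"
proof -
  obtain r where r: "0 < r" "g \<in> Lp_loc p" "(mean_oscillation p r g \<longlongrightarrow> 0) at_infinity"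
    using assms by (auto simp: VMO_def VMO_r_def)
  interpret local_Lp p r g by unfold_locales (use assms r in auto)
  show ?thesis using r(3) by (rule compact_hankel)
qed

theorem theorem3p5:
  fixes m :: nat and p :: real and g :: "complex \<Rightarrow> complex"
  assumes "1 \<le> p"
    and "g \<in> VMO p"
    and "g \<in> Omega m"
  shows "compact_operator p m (hankel_domain p m g) (hankel m g) \<and>
         compact_operator p m (hankel_domain p m (\<lambda>v. cnj (g v))) (hankel m (\<lambda>v. cnj (g v)))"
  using assms compact_hankel_VMO VMO_cnj by blast

end
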